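(* Let $a\le b\le c$ be positive integers. Then $$\Theta_{a,b,c}\text{ is metrizable}\quad\Longleftrightarrow\quad a\le 2\ \text{ or }\ (a,b,c)=(3,3,3).$$ Equivalently, $\Theta_{a,b,c}$ is non-metrizable if and only if $a\ge 3$, $b\ge 3$ and $c\ge 4$. Moreover, $$\Theta_{a,b,c}\text{ is strictly metrizable}\quad\Longleftrightarrow\quad a\le 2.$$
   Context: All graphs are finite and connected; all paths are simple. For positive integers $a,b,c$, the theta graph $\Theta_{a,b,c}$ consists of two branch vertices $s,t$ joined by three internally disjoint $s$--$t$ paths (called arms) having $a$, $b$, $c$ edges respectively. A path system $\mathcal P$ in a graph $G=(V,E)$ is a choice, for every unordered pair $\{u,v\}$ of distinct vertices, of one simple $u$--$v$ path $P_{u,v}$ (a path and its reversal are identified). It is consistent if whenever $x,y$ lie on $P_{u,v}$, the subpath of $P_{u,v}$ between $x$ and $y$ equals $P_{x,y}$. For $w:E\to(0,\infty)$ and a path $Q$, put $w(Q)=\sum_{e\in E(Q)}w(e)$. The weighting $w$ induces $\mathcal P$ if every $P_{u,v}$ has minimum $w$-length among all $u$--$v$ paths of $G$ (ties allowed); it strictly induces $\mathcal P$ if every $P_{u,v}$ is the unique $u$--$v$ path of minimum $w$-length. A path system is metrizable (respectively strictly metrizable) if some positive edge weighting induces (respectively strictly induces) it. A graph is metrizable (respectively strictly metrizable) if every consistent path system in it is metrizable (respectively strictly metrizable). *)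

theory Defs
  imports Complex_Main
begin

text \<open>Undirected graphs are given by an incidence map \<open>ends\<close> from edges to sets of endpoints, so
  that parallel edges are allowed. They occur in the theta graphs with two or three arms of length
  one; all other theta graphs are simple.\<close>

record ('v, 'e) graph =
  verts :: "'v set"
  edges :: "'e set"
  ends :: "'e \<Rightarrow> 'v set"

text \<open>A path is stored with a direction, as its sequence of vertices together with its sequence of
  edges; the \<open>i\<close>-th edge joins the \<open>i\<close>-th and the \<open>Suc i\<close>-th vertex.\<close>

datatype ('v, 'e) path = Path (pverts: "'v list") (pedges: "'e list")

definition is_path :: "('v, 'e) graph \<Rightarrow> 'v \<Rightarrow> 'v \<Rightarrow> ('v, 'e) path \<Rightarrow> bool" where
  "is_path G u v Q \<longleftrightarrow>
     length (pverts Q) = Suc (length (pedges Q)) \<and>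
     hd (pverts Q) = u \<and> last (pverts Q) = v \<and>
     set (pverts Q) \<subseteq> verts G \<and> distinct (pverts Q) \<and>
     (\<forall>i < length (pedges Q).
        pedges Q ! i \<in> edges G \<and> ends G (pedges Q ! i) = {pverts Q ! i, pverts Q ! Suc i})"

definition rev_path :: "('v, 'e) path \<Rightarrow> ('v, 'e) path" where
  "rev_path Q = Path (rev (pverts Q)) (rev (pedges Q))"

text \<open>The part of a path between its vertices at positions \<open>i \<le> j\<close>.\<close>

definition subpath :: "('v, 'e) path \<Rightarrow> nat \<Rightarrow> nat \<Rightarrow> ('v, 'e) path" where
  "subpath Q i j = Path (take (Suc (j - i)) (drop i (pverts Q))) (take (j - i) (drop i (pedges Q)))"

text \<open>A path system is a function of ordered pairs; the choice of a path, up to reversal, for every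
  unordered pair is expressed by requiring that \<open>P v u\<close> is the reversal of \<open>P u v\<close>. The values on
  the diagonal are irrelevant.\<close>

definition path_system :: "('v, 'e) graph \<Rightarrow> ('v \<Rightarrow> 'v \<Rightarrow> ('v, 'e) path) \<Rightarrow> bool" where
  "path_system G P \<longleftrightarrow>
     (\<forall>u \<in> verts G. \<forall>v \<in> verts G. u \<noteq> v \<longrightarrow>
        is_path G u v (P u v) \<and> P v u = rev_path (P u v))"

text \<open>Since \<open>P v u\<close> is the reversal of \<open>P u v\<close>, it suffices to compare subpaths in the direction in
  which \<open>P u v\<close> is traversed.\<close>

definition consistent :: "('v, 'e) graph \<Rightarrow> ('v \<Rightarrow> 'v \<Rightarrow> ('v, 'e) path) \<Rightarrow> bool" where
  "consistent G P \<longleftrightarrow>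
     (\<forall>u \<in> verts G. \<forall>v \<in> verts G. u \<noteq> v \<longrightarrow>
        (\<forall>i j. i < j \<and> j < length (pverts (P u v)) \<longrightarrow>
           subpath (P u v) i j = P (pverts (P u v) ! i) (pverts (P u v) ! j)))"

definition path_weight :: "('e \<Rightarrow> real) \<Rightarrow> ('v, 'e) path \<Rightarrow> real" where
  "path_weight w Q = (\<Sum>e \<in> set (pedges Q). w e)"

definition induces ::
    "('v, 'e) graph \<Rightarrow> ('e \<Rightarrow> real) \<Rightarrow> ('v \<Rightarrow> 'v \<Rightarrow> ('v, 'e) path) \<Rightarrow> bool" where
  "induces G w P \<longleftrightarrow>
     (\<forall>u \<in> verts G. \<forall>v \<in> verts G. u \<noteq> v \<longrightarrow>
        (\<forall>Q. is_path G u v Q \<longrightarrow> path_weight w (P u v) \<le> path_weight w Q))"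

definition strictly_induces ::
    "('v, 'e) graph \<Rightarrow> ('e \<Rightarrow> real) \<Rightarrow> ('v \<Rightarrow> 'v \<Rightarrow> ('v, 'e) path) \<Rightarrow> bool" where
  "strictly_induces G w P \<longleftrightarrow>
     (\<forall>u \<in> verts G. \<forall>v \<in> verts G. u \<noteq> v \<longrightarrow>
        (\<forall>Q. is_path G u v Q \<and> Q \<noteq> P u v \<longrightarrow> path_weight w (P u v) < path_weight w Q))"

definition metrizable_system ::
    "('v, 'e) graph \<Rightarrow> ('v \<Rightarrow> 'v \<Rightarrow> ('v, 'e) path) \<Rightarrow> bool" where
  "metrizable_system G P \<longleftrightarrow> (\<exists>w. (\<forall>e \<in> edges G. w e > 0) \<and> induces G w P)"

definition strictly_metrizable_system ::
    "('v, 'e) graph \<Rightarrow> ('v \<Rightarrow> 'v \<Rightarrow> ('v, 'e) path) \<Rightarrow> bool" where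
  "strictly_metrizable_system G P \<longleftrightarrow> (\<exists>w. (\<forall>e \<in> edges G. w e > 0) \<and> strictly_induces G w P)"

definition metrizable :: "('v, 'e) graph \<Rightarrow> bool" where
  "metrizable G \<longleftrightarrow> (\<forall>P. path_system G P \<and> consistent G P \<longrightarrow> metrizable_system G P)"

definition strictly_metrizable :: "('v, 'e) graph \<Rightarrow> bool" where
  "strictly_metrizable G \<longleftrightarrow>
     (\<forall>P. path_system G P \<and> consistent G P \<longrightarrow> strictly_metrizable_system G P)"

text \<open>The arms of a theta graph are numbered \<open>0, 1, 2\<close>. The edge \<open>(i, j)\<close> is the one on arm \<open>i\<close>
  joining the vertices at distance \<open>j\<close> and \<open>Suc j\<close> from \<open>BranchS\<close> along that arm.\<close>

datatype theta_vertex = BranchS | BranchT | Inner nat nat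

definition arm_vertex :: "nat \<Rightarrow> nat \<Rightarrow> nat \<Rightarrow> theta_vertex" where
  "arm_vertex l i j = (if j = 0 then BranchS else if j = l then BranchT else Inner i j)"

definition theta :: "nat \<Rightarrow> nat \<Rightarrow> nat \<Rightarrow> (theta_vertex, nat \<times> nat) graph" where
  "theta a b c =
     \<lparr> verts = {arm_vertex ([a, b, c] ! i) i j | i j. i < 3 \<and> j \<le> [a, b, c] ! i},
       edges = {(i, j). i < 3 \<and> j < [a, b, c] ! i},
       ends = (\<lambda>(i, j). {arm_vertex ([a, b, c] ! i) i j, arm_vertex ([a, b, c] ! i) i (Suc j)}) \<rparr>"

end

theory Submission
  imports Defs
begin

text \<open>In a consistent path system \<open>P\<close> of a theta graph, one arm \<open>X\<close> is the system path between the two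
branch vertices \<open>S\<close> and \<open>T\<close>, and every system path through both branch vertices runs along \<open>X\<close>
between them. Given edge weights, let the potential of a vertex be its distance to \<open>T\<close> minus its
distance to \<open>S\<close>, both measured along its arm. If \<open>h i j\<close> is the potential at position \<open>j\<close> of arm \<open>i\<close>,
then \<open>h i 0\<close> is the weight of the arm, and the potentials decrease along it to \<open>- h i 0\<close>. The
weights induce \<open>P\<close> as soon as the potentials satisfy a few linear conditions (\<open>realizes\<close>): \<open>X\<close> is a lightest arm; two vertices of an arm \<open>i \<noteq> X\<close> are joined
along it if and only if their potentials differ by less than \<open>h i 0 + h X 0\<close>; and two vertices of
different arms are joined through \<open>S\<close> or \<open>T\<close> according to the sign of the sum of their potentials.
To see this, one only needs that two vertices of one arm are joined by at most three paths, and two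
inner vertices of different arms by four (\<open>same_arm_path\<close>, \<open>cross_arm_path\<close>).

Call a vertex normal if its paths to \<open>S\<close> and \<open>T\<close> stay on its arm; its potential then lies between
\<open>- h X 0\<close> and \<open>h X 0\<close>, and all other potentials lie outside. The sign conditions matter only for pairs
of normal vertices, because for the others they follow from these bounds; and the vertices that are
not normal can always be placed outside the bounds so as to satisfy the conditions within their arm
(\<open>realizes_extend_potential\<close>). There remains a core problem: find three decreasing sequences, one
for the normal vertices of each arm, such that the sums of terms from different sequences have
prescribed signs. Consistency makes these signs monotone in both positions.

For two sequences the core problem is the realization of a Ferrers relation and is always solvable.
If the third arm has only one normal vertex, its potential has to cut each of the two sequences at
a prescribed place, and both cuts are met after translating the sequences against each other. This
proves strict metrizability when some arm has length at most 2, hence at most one inner vertex.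

If all arms have at least two inner vertices \<open>x1, x2, \<dots>\<close> and \<open>y1, y2, \<dots>\<close> and \<open>z1, z2, \<dots>\<close>, the
cyclic pattern in which \<open>x1 + y2\<close>, \<open>y1 + z2\<close>, \<open>z1 + x2\<close> are to be positive and \<open>x2 + y1\<close>, \<open>y2 + z1\<close>,
\<open>z2 + x1\<close> negative is contradictory, since both triples have the same sum. So there is no strict
realization. With nonstrict inequalities, equality throughout is still possible: for lengths
\<open>(3, 3, 3)\<close>, equal weights induce this system and all others in which every inner vertex is normal
and no two arms have all their inner vertices joined through the same branch vertex. The remaining
systems for these lengths have a strict realization, because some arm has at most one normal vertex or by a
large translation (\<open>core_potential_if_pair_one_sided\<close>). For other lengths of at
least 3, the longest arm has a further inner vertex \<open>z3\<close>, and requiring \<open>y1 + z3 \<ge> 0\<close> in place of \<open>y1 + z2 \<ge> 0\<close> forces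
\<open>z3 \<ge> z2\<close>, which positive weights exclude.\<close>

section \<open>Joining, reversing and decomposing paths\<close>

text \<open>The second path is meant to start at the last vertex of the first; this vertex is kept once.\<close>

definition join :: "('v, 'e) path \<Rightarrow> ('v, 'e) path \<Rightarrow> ('v, 'e) path" (infixr "\<frown>" 65) where
  "Q \<frown> R = Path (pverts Q @ tl (pverts R)) (pedges Q @ pedges R)"

text \<open>All that computations with positions in joined paths need, without reference to a graph.\<close>

definition wf_path :: "('v, 'e) path \<Rightarrow> bool" where
  "wf_path Q \<longleftrightarrow> length (pverts Q) = Suc (length (pedges Q))"

lemma join_assoc: "pverts R \<noteq> [] \<Longrightarrow> (Q \<frown> R) \<frown> S = Q \<frown> R \<frown> S"
  by (simp add: join_def)

lemma wf_join [simp]: "wf_path Q \<Longrightarrow> wf_path R \<Longrightarrow> wf_path (Q \<frown> R)"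
  by (simp add: wf_path_def join_def)

lemma hd_pverts_join [simp]: "pverts Q \<noteq> [] \<Longrightarrow> hd (pverts (Q \<frown> R)) = hd (pverts Q)"
  by (simp add: join_def)

lemma last_pverts_join:
  assumes "pverts R \<noteq> []" "last (pverts Q) = hd (pverts R)"
  shows "last (pverts (Q \<frown> R)) = last (pverts R)"
  using assms by (cases "pverts R") (auto simp: join_def)

lemma pverts_join_nonempty [simp]: "pverts Q \<noteq> [] \<Longrightarrow> pverts (Q \<frown> R) \<noteq> []"
  by (simp add: join_def)

lemma set_pverts_join:
  assumes "pverts Q \<noteq> []" "pverts R \<noteq> []" "last (pverts Q) = hd (pverts R)"
  shows "set (pverts (Q \<frown> R)) = set (pverts Q) \<union> set (pverts R)"
  using assms last_in_set[OF assms(1)] by (cases "pverts R") (auto simp: join_def)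

lemma nth_join: "i < length (pverts Q) \<Longrightarrow> pverts (Q \<frown> R) ! i = pverts Q ! i"
  by (simp add: join_def nth_append)

lemma join_trivial: "pverts Q \<noteq> [] \<Longrightarrow> Path [hd (pverts Q)] [] \<frown> Q = Q"
  by (cases Q) (simp add: join_def)

lemma join_common_vertex:
  assumes "distinct (pverts (Q \<frown> R))" "x \<in> set (pverts Q)" "x \<in> set (pverts R)"
  shows "x = hd (pverts R)"
  using assms by (cases "pverts R") (auto simp: join_def)

lemma distinct_join_right:
  assumes "distinct (pverts (Q \<frown> R))" "last (pverts Q) = hd (pverts R)" "pverts Q \<noteq> []"
  shows "distinct (pverts R)"
  using assms by (cases "pverts R") (auto simp: join_def dest: last_in_set)

lemma rev_path_rev_path [simp]: "rev_path (rev_path Q) = Q"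
  by (simp add: rev_path_def)

lemma rev_path_inject: "rev_path Q = rev_path R \<longleftrightarrow> Q = R"
  by (metis rev_path_rev_path)

lemma rev_path_join:
  assumes "pverts Q \<noteq> []" and "pverts R \<noteq> []" and "last (pverts Q) = hd (pverts R)"
  shows "rev_path (Q \<frown> R) = rev_path R \<frown> rev_path Q"
proof -
  have "rev (tl (pverts R)) @ rev (pverts Q) = rev (tl (pverts R)) @ last (pverts Q) # tl (rev (pverts Q))"
    using assms(1) by (metis hd_rev list.collapse rev_is_Nil_conv)
  also have "\<dots> = rev (pverts R) @ tl (rev (pverts Q))"
    using assms(2,3) by (metis append_Cons append_Nil append_assoc hd_Cons_tl rev.simps(2))
  finally show ?thesis
    by (simp add: join_def rev_path_def)
qed

lemma is_path_join:
  assumes "is_path G u x Q" and "is_path G x v R"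
    and "set (pverts Q) \<inter> set (tl (pverts R)) = {}"
  shows "is_path G u v (Q \<frown> R)"
proof -
  let ?n = "length (pedges Q)"
  have Q: "length (pverts Q) = Suc ?n" "hd (pverts Q) = u" "last (pverts Q) = x"
    "set (pverts Q) \<subseteq> verts G" "distinct (pverts Q)"
    "\<And>i. i < ?n \<Longrightarrow> pedges Q ! i \<in> edges G \<and> ends G (pedges Q ! i) = {pverts Q ! i, pverts Q ! Suc i}"
    using assms(1) by (auto simp: is_path_def)
  have R: "length (pverts R) = Suc (length (pedges R))" "hd (pverts R) = x" "last (pverts R) = v"
    "set (pverts R) \<subseteq> verts G" "distinct (pverts R)"
    "\<And>i. i < length (pedges R) \<Longrightarrow> pedges R ! i \<in> edges G \<and> ends G (pedges R ! i) = {pverts R ! i, pverts R ! Suc i}"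
    using assms(2) by (auto simp: is_path_def)
  have ne: "pverts Q \<noteq> []" "pverts R \<noteq> []"
    using Q(1) R(1) by auto
  have tail: "(pverts Q @ tl (pverts R)) ! (?n + i) = pverts R ! i" if "i < length (pverts R)" for i
  proof (cases i)
    case 0
    then show ?thesis
      using Q(1,3) R(2) ne by (simp add: nth_append last_conv_nth hd_conv_nth)
  next
    case (Suc k)
    then show ?thesis
      using Q(1) that by (simp add: nth_append nth_tl)
  qed
  have ends: "(pedges Q @ pedges R) ! i \<in> edges G \<and>
      ends G ((pedges Q @ pedges R) ! i) =
        {(pverts Q @ tl (pverts R)) ! i, (pverts Q @ tl (pverts R)) ! Suc i}"
    if i: "i < ?n + length (pedges R)" for i
  proof (cases "i < ?n")
    case True
    then show ?thesis
      using Q(1,6) by (simp add: nth_append)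
  next
    case False
    then obtain k where k: "i = ?n + k"
      by (metis le_Suc_ex not_less)
    then have "k < length (pedges R)"
      using i by simp
    then show ?thesis
      using R(1) R(6)[of k] tail[of k] tail[of "Suc k"] k by (simp add: nth_append)
  qed
  have "last (pverts Q @ tl (pverts R)) = v"
    using R(2,3) Q(3) ne by (cases "pverts R") auto
  moreover have "set (tl (pverts R)) \<subseteq> verts G" "distinct (tl (pverts R))"
    using R(4,5) using list.set_sel(2)[OF ne(2)] by (auto simp: distinct_tl)
  ultimately show ?thesis
    using Q R(1) ne assms(3) ends by (auto simp: is_path_def join_def)
qed

lemma is_path_rev:
  assumes "is_path G u v Q"
  shows "is_path G v u (rev_path Q)"
proof -
  let ?n = "length (pedges Q)"
  have Q: "length (pverts Q) = Suc ?n"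
    "\<And>i. i < ?n \<Longrightarrow> pedges Q ! i \<in> edges G \<and> ends G (pedges Q ! i) = {pverts Q ! i, pverts Q ! Suc i}"
    using assms by (auto simp: is_path_def)
  have "rev (pedges Q) ! i \<in> edges G \<and>
      ends G (rev (pedges Q) ! i) = {rev (pverts Q) ! i, rev (pverts Q) ! Suc i}" if "i < ?n" for i
  proof -
    have "Suc (?n - Suc i) = ?n - i"
      using that by simp
    then show ?thesis
      using Q(1) Q(2)[of "?n - Suc i"] that by (auto simp: rev_nth)
  qed
  then show ?thesis
    using assms by (auto simp: is_path_def rev_path_def hd_rev last_rev)
qed

lemma is_path_Cons:
  "is_path G u v (Path (x # y # vs) (e # es)) \<longleftrightarrow>
     u = x \<and> x \<in> verts G \<and> x \<notin> set (y # vs) \<and> e \<in> edges G \<and> ends G e = {x, y} \<and>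
     is_path G y v (Path (y # vs) es)"
  by (auto simp: is_path_def All_less_Suc2)

lemma is_path_cases:
  assumes "is_path G u v Q"
  obtains (trivial) "Q = Path [u] []" "u = v"
  | (step) y vs e es where "Q = Path (u # y # vs) (e # es)"
      "u \<in> verts G" "u \<notin> set (y # vs)" "e \<in> edges G" "ends G e = {u, y}"
      "is_path G y v (Path (y # vs) es)"
proof (cases "pedges Q")
  case Nil
  then have "pverts Q = [u]" "u = v"
    using assms by (auto simp: is_path_def length_Suc_conv)
  then show ?thesis
    using Nil trivial by (metis path.collapse)
next
  case (Cons e es)
  then obtain x y vs where "pverts Q = x # y # vs"
    using assms by (auto simp: is_path_def length_Suc_conv)
  then have Q: "Q = Path (x # y # vs) (e # es)"
    using Cons by (metis path.collapse)
  show ?thesis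
    using step[of y vs e es] assms unfolding Q is_path_Cons by auto
qed

lemma trivial_path: "is_path G u v Q \<Longrightarrow> pedges Q = [] \<Longrightarrow> u = v"
  by (erule is_path_cases) auto

lemma hd_pverts_path: "is_path G u v Q \<Longrightarrow> hd (pverts Q) = u"
  and pverts_path_nonempty: "is_path G u v Q \<Longrightarrow> pverts Q \<noteq> []"
  and last_pverts_path: "is_path G u v Q \<Longrightarrow> last (pverts Q) = v"
  and distinct_path: "is_path G u v Q \<Longrightarrow> distinct (pverts Q)"
  by (auto simp: is_path_def)

text \<open>Consistency in the form in which it is used below: when a system path is written as a join, its
two parts are system paths.\<close>

lemma consistent_prefix:
  assumes "consistent G P" and "u \<in> verts G" "v \<in> verts G" "u \<noteq> v" "is_path G u v (P u v)"
    and "P u v = Q \<frown> R" and "wf_path Q" "wf_path R" and "pedges Q \<noteq> []"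
  shows "P u (last (pverts Q)) = Q"
proof -
  let ?n = "length (pedges Q)"
  have ne: "pverts Q \<noteq> []"
    using assms(7) by (auto simp: wf_path_def)
  have "?n < length (pverts (P u v))"
    using assms(6,7) by (simp add: wf_path_def join_def)
  then have "subpath (P u v) 0 ?n = P (pverts (P u v) ! 0) (pverts (P u v) ! ?n)"
    using assms(1-4,9) unfolding consistent_def by blast
  moreover have "subpath (P u v) 0 ?n = Q"
    using assms(6,7) by (simp add: subpath_def join_def wf_path_def)
  moreover have "pverts (P u v) ! 0 = u"
    using assms(5) by (simp add: is_path_def hd_conv_nth[symmetric] flip: length_greater_0_conv)
  moreover have "pverts (P u v) ! ?n = last (pverts Q)"
    using assms(6,7) ne by (simp add: join_def wf_path_def nth_append last_conv_nth)
  ultimately show ?thesis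
    by simp
qed

lemma consistent_suffix:
  assumes "consistent G P" and "u \<in> verts G" "v \<in> verts G" "u \<noteq> v" "is_path G u v (P u v)"
    and "P u v = Q \<frown> R" and "wf_path Q" "wf_path R" and "pedges R \<noteq> []"
    and "last (pverts Q) = hd (pverts R)"
  shows "P (hd (pverts R)) v = R"
proof -
  let ?m = "length (pedges Q)" and ?n = "length (pedges R)"
  have ne: "pverts Q \<noteq> []" "pverts R \<noteq> []"
    using assms(7,8) by (auto simp: wf_path_def)
  have "?m < ?m + ?n" "?m + ?n < length (pverts (P u v))"
    using assms(6-9) by (simp_all add: wf_path_def join_def)
  then have "subpath (P u v) ?m (?m + ?n) = P (pverts (P u v) ! ?m) (pverts (P u v) ! (?m + ?n))"
    using assms(1-4) unfolding consistent_def by blast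
  moreover have "drop ?m (pverts Q) = [hd (pverts R)]"
    using assms(7,10) ne by (metis append_butlast_last_id append_eq_conv_conj diff_Suc_1 length_butlast wf_path_def)
  then have "subpath (P u v) ?m (?m + ?n) = R"
    using assms(6,7,8) ne by (simp add: subpath_def join_def wf_path_def)
  moreover have "pverts (P u v) ! ?m = hd (pverts R)"
    using assms(6,7,10) ne by (simp add: join_def wf_path_def nth_append last_conv_nth)
  moreover have "pverts (P u v) ! (?m + ?n) = last (pverts (P u v))"
    using assms(6,7,8) ne by (subst last_conv_nth) (auto simp: join_def wf_path_def)
  moreover have "last (pverts (P u v)) = v"
    using assms(5) by (simp add: is_path_def)
  ultimately show ?thesis
    by simp
qed

lemma path_weight_join:
  "set (pedges Q) \<inter> set (pedges R) = {} \<Longrightarrow>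
     path_weight w (Q \<frown> R) = path_weight w Q + path_weight w R"
  by (simp add: path_weight_def join_def sum.union_disjoint)

lemma path_weight_rev_path [simp]: "path_weight w (rev_path Q) = path_weight w Q"
  by (simp add: path_weight_def rev_path_def)

lemma strictly_metrizable_system_imp_metrizable_system:
  assumes "strictly_metrizable_system G P"
  shows "metrizable_system G P"
proof -
  obtain w where w: "\<forall>e\<in>edges G. 0 < w e" "strictly_induces G w P"
    using assms by (auto simp: strictly_metrizable_system_def)
  have "induces G w P"
    unfolding induces_def
  proof (intro ballI impI allI)
    fix u v Q assume "u \<in> verts G" "v \<in> verts G" "u \<noteq> v" "is_path G u v Q"
    then show "path_weight w (P u v) \<le> path_weight w Q"
      using w(2) unfolding strictly_induces_def by (cases "Q = P u v") (auto intro: less_imp_le)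
  qed
  then show ?thesis
    using w(1) by (auto simp: metrizable_system_def)
qed

section \<open>Segments of an arm\<close>

text \<open>The part of arm \<open>i\<close>, of length \<open>l\<close>, between positions \<open>j\<close> and \<open>k\<close>. It is traversed backwards if
\<open>k < j\<close>, so that reversal just exchanges the two positions.\<close>

definition leg :: "nat \<Rightarrow> nat \<Rightarrow> nat \<Rightarrow> nat \<Rightarrow> (theta_vertex, nat \<times> nat) path" where
  "leg l i j k =
     (if j \<le> k then Path (map (arm_vertex l i) [j..<Suc k]) (map (Pair i) [j..<k])
      else Path (rev (map (arm_vertex l i) [k..<Suc j])) (rev (map (Pair i) [k..<j])))"

lemma leg_refl: "leg l i j j = Path [arm_vertex l i j] []"
  by (simp add: leg_def)

lemma wf_leg [simp]: "wf_path (leg l i j k)"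
  by (simp add: wf_path_def leg_def)

lemma pverts_leg_nonempty [simp]: "pverts (leg l i j k) \<noteq> []"
  by (simp add: leg_def)

lemma hd_leg [simp]: "hd (pverts (leg l i j k)) = arm_vertex l i j"
proof (cases "j \<le> k")
  case True
  then show ?thesis
    by (simp add: leg_def upt_conv_Cons del: upt_Suc)
next
  case False
  then show ?thesis
    by (simp add: leg_def)
qed

lemma rev_path_leg [simp]: "rev_path (leg l i j k) = leg l i k j"
  by (auto simp: leg_def rev_path_def)

lemma last_leg [simp]: "last (pverts (leg l i j k)) = arm_vertex l i k"
proof -
  have "last (pverts (rev_path (leg l i k j))) = hd (pverts (leg l i k j))"
    unfolding rev_path_def by (simp add: last_rev)
  then show ?thesis
    by simp
qed

lemma set_leg: "set (pverts (leg l i j k)) = arm_vertex l i ` {min j k..max j k}"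
  by (auto simp: leg_def min_def max_def simp del: upt_Suc)

lemma pedges_leg: "set (pedges (leg l i j k)) = Pair i ` {min j k..<max j k}"
  by (auto simp: leg_def min_def max_def simp del: upt_Suc)

lemma pedges_leg_empty [simp]: "pedges (leg l i j k) = [] \<longleftrightarrow> j = k"
  by (auto simp: leg_def)

lemma length_pedges_leg: "length (pedges (leg l i j k)) = (if j < k then k - j else j - k)"
  by (simp add: leg_def)

lemma leg_up: "j < k \<Longrightarrow> leg l i j k = Path (arm_vertex l i j # pverts (leg l i (Suc j) k)) ((i, j) # pedges (leg l i (Suc j) k))"
  by (simp add: leg_def upt_conv_Cons del: upt_Suc)

lemma leg_down: "k < j \<Longrightarrow> leg l i j k = Path (arm_vertex l i j # pverts (leg l i (j - 1) k)) ((i, j - 1) # pedges (leg l i (j - 1) k))"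
  by (cases j) (auto simp: leg_def dest: le_antisym)

lemma leg_split_up:
  assumes "j \<le> m" and "m \<le> k"
  shows "leg l i j k = leg l i j m \<frown> leg l i m k"
proof -
  have "[j..<k] = [j..<m] @ [m..<k]" "[j..<Suc k] = [j..<Suc m] @ [Suc m..<Suc k]"
    using assms upt_add_eq_append[of j m "k - m"] upt_add_eq_append[of j "Suc m" "k - m"] by auto
  then show ?thesis
    using assms by (simp add: leg_def join_def upt_conv_Cons del: upt_Suc)
qed

lemma leg_split_down:
  assumes "k \<le> m" and "m \<le> j"
  shows "leg l i j k = leg l i j m \<frown> leg l i m k"
proof -
  have "rev_path (leg l i k j) = rev_path (leg l i k m \<frown> leg l i m j)"
    using assms by (subst leg_split_up) auto
  then show ?thesis
    by (simp add: rev_path_join)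
qed

lemma hd_pedges_leg: "j \<noteq> k \<Longrightarrow> hd (pedges (leg l i j k)) = (i, if j < k then j else j - 1)"
  by (cases "j < k") (auto simp: leg_up[of j k] leg_down[of k j])

lemma join_leg_refl [simp]: "Q \<frown> leg l i j j = Q"
  by (cases Q) (simp add: join_def leg_refl)

definition arm_dist :: "(nat \<times> nat \<Rightarrow> real) \<Rightarrow> nat \<Rightarrow> nat \<Rightarrow> real" where
  "arm_dist w i j = (\<Sum>x<j. w (i, x))"

lemma arm_dist_0 [simp]: "arm_dist w i 0 = 0"
  by (simp add: arm_dist_def)

lemma path_weight_leg_up:
  assumes "j \<le> k"
  shows "path_weight w (leg l i j k) = arm_dist w i k - arm_dist w i j"
proof -
  have "path_weight w (leg l i j k) = (\<Sum>x\<in>{j..<k}. w (i, x))"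
    using assms by (simp add: path_weight_def pedges_leg sum.reindex inj_on_def)
  also have "\<dots> = (\<Sum>x<k. w (i, x)) - (\<Sum>x<j. w (i, x))"
    using assms sum_diff_nat_ivl[of 0 j k "\<lambda>x. w (i, x)"] by (simp add: atLeast0LessThan)
  finally show ?thesis
    by (simp add: arm_dist_def)
qed

lemma path_weight_leg_down:
  "k \<le> j \<Longrightarrow> path_weight w (leg l i j k) = arm_dist w i j - arm_dist w i k"
  using path_weight_leg_up[of k j w l i] path_weight_rev_path[of w "leg l i k j"] by simp

section \<open>The paths of a theta graph\<close>

locale theta_arms =
  fixes a b c :: nat
  assumes arms_nonempty: "1 \<le> a" "1 \<le> b" "1 \<le> c"
begin

definition len :: "nat \<Rightarrow> nat" where
  "len i = [a, b, c] ! i"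

abbreviation vx :: "nat \<Rightarrow> nat \<Rightarrow> theta_vertex" where
  "vx i j \<equiv> arm_vertex (len i) i j"

abbreviation seg :: "nat \<Rightarrow> nat \<Rightarrow> nat \<Rightarrow> (theta_vertex, nat \<times> nat) path" where
  "seg i j k \<equiv> leg (len i) i j k"

abbreviation G :: "(theta_vertex, nat \<times> nat) graph" where
  "G \<equiv> theta a b c"

lemma len_pos [simp]: "i < 3 \<Longrightarrow> 0 < len i"
  using arms_nonempty by (auto simp: len_def numeral_3_eq_3 less_Suc_eq)

lemma verts_G: "verts G = {vx i j |i j. i < 3 \<and> j \<le> len i}"
  by (simp add: theta_def len_def)

lemma edges_G: "(i, j) \<in> edges G \<longleftrightarrow> i < 3 \<and> j < len i"
  by (simp add: theta_def len_def)

lemma ends_G: "ends G (i, j) = {vx i j, vx i (Suc j)}"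
  by (simp add: theta_def len_def)

lemma vx_in_G [simp]: "i < 3 \<Longrightarrow> j \<le> len i \<Longrightarrow> vx i j \<in> verts G"
  by (auto simp: verts_G)

lemma vx_0 [simp]: "vx i 0 = BranchS"
  by (simp add: arm_vertex_def)

lemma vx_len [simp]: "i < 3 \<Longrightarrow> vx i (len i) = BranchT"
  using len_pos[of i] by (auto simp: arm_vertex_def)

lemma vx_inner: "0 < j \<Longrightarrow> j < len i \<Longrightarrow> vx i j = Inner i j"
  by (simp add: arm_vertex_def)

lemma vx_eq_iff:
  assumes "i < 3" "i' < 3" "j \<le> len i" "j' \<le> len i'"
  shows "vx i j = vx i' j' \<longleftrightarrow> (j = 0 \<and> j' = 0) \<or> (j = len i \<and> j' = len i') \<or> (i = i' \<and> j = j')"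
  using len_pos[OF assms(1)] len_pos[OF assms(2)] assms(3,4) by (auto simp: arm_vertex_def)

text \<open>An inner vertex of an arm has only two edges, so a path that moves along an arm cannot turn around
before it ends or reaches the branch vertex ahead.\<close>

lemma path_up:
  assumes "i < 3" "j < len i" "is_path G (vx i j) w (Path (vx i j # vs) ((i, j) # es))"
  shows "(\<exists>k. j < k \<and> k \<le> len i \<and> Path (vx i j # vs) ((i, j) # es) = seg i j k) \<or>
    (\<exists>R. is_path G BranchT w R \<and> pedges R \<noteq> [] \<and>
       Path (vx i j # vs) ((i, j) # es) = seg i j (len i) \<frown> R)"
  using assms(2,3)
proof (induction "len i - j" arbitrary: j vs es rule: less_induct)
  case less
  obtain y vs' where vs: "vs = y # vs'"
    using less.prems(2) by (cases vs) (auto simp: is_path_def)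
  have step: "vx i j \<notin> set (y # vs')" "{vx i j, vx i (Suc j)} = {vx i j, y}"
    "is_path G y w (Path (y # vs') es)"
    using less.prems(2) by (auto simp: vs is_path_Cons ends_G)
  then have y: "y = vx i (Suc j)"
    by (auto simp: doubleton_eq_iff)
  show ?case
  proof (cases es)
    case Nil
    then have "vs' = []"
      using step(3) by (auto simp: is_path_def)
    then have "Path (vx i j # vs) ((i, j) # es) = seg i j (Suc j)"
      using Nil by (simp add: leg_up leg_refl vs y)
    then show ?thesis
      using less.prems(1) by (metis Suc_leI lessI)
  next
    case (Cons e es')
    show ?thesis
    proof (cases "Suc j = len i")
      case True
      then have "y = BranchT"
        using assms(1) y by simp
      moreover have "Path (vx i j # vs) ((i, j) # es) = seg i j (len i) \<frown> Path (y # vs') es"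
        by (simp add: leg_up[of j "Suc j"] leg_refl vs y join_def flip: True)
      ultimately show ?thesis
        using step(3) Cons by (metis list.distinct(1) path.sel(2))
    next
      case False
      then have j: "Suc j < len i"
        using less.prems(1) by simp
      obtain i' j' where e: "e = (i', j')"
        by (cases e)
      obtain z vs'' where vs': "vs' = z # vs''"
        using step(3) Cons by (cases vs') (auto simp: is_path_def)
      have e': "(i', j') \<in> edges G" "{vx i' j', vx i' (Suc j')} = {y, z}"
        using step(3) by (auto simp: vs' Cons e is_path_Cons ends_G)
      then have "Inner i (Suc j) \<in> {vx i' j', vx i' (Suc j')}"
        using j by (auto simp: y vx_inner)
      then have "i' = i" "j' = j \<or> j' = Suc j"
        using e'(1) by (auto simp: arm_vertex_def edges_G split: if_splits)
      moreover have "j' \<noteq> j"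
      proof
        assume "j' = j"
        then have "z = vx i j \<or> z = y"
          using e'(2) \<open>i' = i\<close> y by (auto simp: doubleton_eq_iff)
        then show False
          using step(1,3) vs' Cons by (auto simp: is_path_Cons)
      qed
      ultimately have e: "e = (i, Suc j)"
        using e by simp
      have "is_path G (vx i (Suc j)) w (Path (vx i (Suc j) # vs') ((i, Suc j) # es'))"
        using step(3) by (simp add: y Cons e)
      from less.hyps[OF _ j this] j have
        "(\<exists>k. Suc j < k \<and> k \<le> len i \<and> Path (y # vs') es = seg i (Suc j) k) \<or>
         (\<exists>R. is_path G BranchT w R \<and> pedges R \<noteq> [] \<and> Path (y # vs') es = seg i (Suc j) (len i) \<frown> R)"
        by (simp add: y Cons e)
      then show ?thesis
      proof (elim disjE exE conjE)
        fix k assume "Suc j < k" "k \<le> len i" "Path (y # vs') es = seg i (Suc j) k"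
        then have "j < k \<and> k \<le> len i \<and> Path (vx i j # vs) ((i, j) # es) = seg i j k"
          by (simp add: leg_up[of j k] vs flip: \<open>Path (y # vs') es = seg i (Suc j) k\<close>)
        then show ?thesis
          by blast
      next
        fix R assume R: "is_path G BranchT w R" "pedges R \<noteq> []"
          and eq: "Path (y # vs') es = seg i (Suc j) (len i) \<frown> R"
        have "y # vs' = pverts (seg i (Suc j) (len i)) @ tl (pverts R)"
          "es = pedges (seg i (Suc j) (len i)) @ pedges R"
          using eq by (simp_all add: join_def)
        then have "Path (vx i j # vs) ((i, j) # es) = seg i j (len i) \<frown> R"
          using less.prems(1) by (simp add: leg_up[of j "len i"] vs join_def)
        then show ?thesis
          using R by blast
      qed
    qed
  qed
qed

lemma path_down:
  assumes "i < 3" "j < len i" "is_path G (vx i (Suc j)) w (Path (vx i (Suc j) # vs) ((i, j) # es))"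
  shows "(\<exists>k. k \<le> j \<and> Path (vx i (Suc j) # vs) ((i, j) # es) = seg i (Suc j) k) \<or>
    (\<exists>R. is_path G BranchS w R \<and> pedges R \<noteq> [] \<and>
       Path (vx i (Suc j) # vs) ((i, j) # es) = seg i (Suc j) 0 \<frown> R)"
  using assms(2,3)
proof (induction j arbitrary: vs es rule: less_induct)
  case (less j)
  obtain y vs' where vs: "vs = y # vs'"
    using less.prems(2) by (cases vs) (auto simp: is_path_def)
  have step: "vx i (Suc j) \<notin> set (y # vs')" "{vx i j, vx i (Suc j)} = {vx i (Suc j), y}"
    "is_path G y w (Path (y # vs') es)"
    using less.prems(2) by (auto simp: vs is_path_Cons ends_G)
  then have y: "y = vx i j"
    by (auto simp: doubleton_eq_iff)
  show ?case
  proof (cases es)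
    case Nil
    then have "vs' = []"
      using step(3) by (auto simp: is_path_def)
    then have "Path (vx i (Suc j) # vs) ((i, j) # es) = seg i (Suc j) j"
      using Nil by (simp add: leg_down leg_refl vs y)
    then show ?thesis
      by blast
  next
    case (Cons e es')
    show ?thesis
    proof (cases j)
      case 0
      then have "y = BranchS"
        using y by simp
      moreover have "Path (vx i (Suc j) # vs) ((i, j) # es) = seg i (Suc j) 0 \<frown> Path (y # vs') es"
        using 0 by (simp add: leg_down[of 0 "Suc 0"] leg_refl vs y join_def)
      ultimately show ?thesis
        using step(3) Cons by (metis list.distinct(1) path.sel(2))
    next
      case (Suc k0)
      obtain i' j' where e: "e = (i', j')"
        by (cases e)
      obtain z vs'' where vs': "vs' = z # vs''"
        using step(3) Cons by (cases vs') (auto simp: is_path_def)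
      have e': "(i', j') \<in> edges G" "{vx i' j', vx i' (Suc j')} = {y, z}"
        using step(3) by (auto simp: vs' Cons e is_path_Cons ends_G)
      then have "Inner i j \<in> {vx i' j', vx i' (Suc j')}"
        using Suc less.prems(1) by (auto simp: y vx_inner)
      then have "i' = i" "j' = j \<or> j' = k0"
        using e'(1) Suc by (auto simp: arm_vertex_def edges_G split: if_splits)
      moreover have "j' \<noteq> j"
      proof
        assume "j' = j"
        then have "z = vx i (Suc j) \<or> z = y"
          using e'(2) \<open>i' = i\<close> y by (auto simp: doubleton_eq_iff)
        then show False
          using step(1,3) vs' Cons by (auto simp: is_path_Cons)
      qed
      ultimately have e: "e = (i, k0)"
        using e by simp
      have "is_path G (vx i (Suc k0)) w (Path (vx i (Suc k0) # vs') ((i, k0) # es'))"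
        using step(3) by (simp add: y Cons e Suc)
      from less.IH[OF _ _ this] Suc less.prems(1) have
        "(\<exists>k. k \<le> k0 \<and> Path (y # vs') es = seg i j k) \<or>
         (\<exists>R. is_path G BranchS w R \<and> pedges R \<noteq> [] \<and> Path (y # vs') es = seg i j 0 \<frown> R)"
        by (simp add: y Cons e)
      then show ?thesis
      proof (elim disjE exE conjE)
        fix k assume k: "k \<le> k0" and eq: "Path (y # vs') es = seg i j k"
        have "y # vs' = pverts (seg i j k)" "es = pedges (seg i j k)"
          by (simp_all flip: eq)
        then have "k \<le> j \<and> Path (vx i (Suc j) # vs) ((i, j) # es) = seg i (Suc j) k"
          using k Suc leg_down[of k "Suc j" "len i" i] by (simp add: vs)
        then show ?thesis
          by blast
      next
        fix R assume R: "is_path G BranchS w R" "pedges R \<noteq> []"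
          and eq: "Path (y # vs') es = seg i j 0 \<frown> R"
        have "y # vs' = pverts (seg i j 0) @ tl (pverts R)"
          "es = pedges (seg i j 0) @ pedges R"
          using eq by (simp_all add: join_def)
        then have "Path (vx i (Suc j) # vs) ((i, j) # es) = seg i (Suc j) 0 \<frown> R"
          by (simp add: leg_down[of 0 "Suc j"] vs join_def)
        then show ?thesis
          using R by blast
      qed
    qed
  qed
qed

lemma path_from_T:
  assumes "is_path G BranchT w R" "pedges R \<noteq> []"
  shows "\<exists>m<3. (\<exists>k<len m. R = seg m (len m) k) \<or>
    (\<exists>R'. is_path G BranchS w R' \<and> pedges R' \<noteq> [] \<and> R = seg m (len m) 0 \<frown> R')"
  using assms(1)
proof (cases rule: is_path_cases)
  case trivial
  then show ?thesis
    using assms(2) by simp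
next
  case (step y vs e es)
  obtain m j where e: "e = (m, j)"
    by (cases e)
  then have m: "m < 3" "j < len m"
    using step(4) by (auto simp: edges_G)
  have "BranchT \<in> {vx m j, vx m (Suc j)}"
    using step(5) by (simp add: e ends_G)
  then have j: "Suc j = len m"
    using m by (auto simp: arm_vertex_def split: if_splits)
  have T: "BranchT = vx m (Suc j)"
    using m j by simp
  have "is_path G (vx m (Suc j)) w (Path (vx m (Suc j) # y # vs) ((m, j) # es))"
    using assms(1) unfolding step(1) e T .
  from path_down[OF m this] show ?thesis
    unfolding step(1) e T using m(1) j by (metis le_imp_less_Suc)
qed

lemma path_from_S:
  assumes "is_path G BranchS w R" "pedges R \<noteq> []"
  shows "\<exists>m<3. (\<exists>k\<in>{0<..len m}. R = seg m 0 k) \<or>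
    (\<exists>R'. is_path G BranchT w R' \<and> pedges R' \<noteq> [] \<and> R = seg m 0 (len m) \<frown> R')"
  using assms(1)
proof (cases rule: is_path_cases)
  case trivial
  then show ?thesis
    using assms(2) by simp
next
  case (step y vs e es)
  obtain m j where e: "e = (m, j)"
    by (cases e)
  then have m: "m < 3" "j < len m"
    using step(4) by (auto simp: edges_G)
  have "BranchS \<in> {vx m j, vx m (Suc j)}"
    using step(5) by (simp add: e ends_G)
  then have j: "j = 0"
    using m by (auto simp: arm_vertex_def split: if_splits)
  have "is_path G (vx m 0) w (Path (vx m 0 # y # vs) ((m, 0) # es))"
    using assms(1) unfolding step(1) e j by simp
  from path_up[OF m(1) len_pos[OF m(1)] this] have "(\<exists>k. 0 < k \<and> k \<le> len m \<and> R = seg m 0 k) \<or>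
    (\<exists>R'. is_path G BranchT w R' \<and> pedges R' \<noteq> [] \<and> R = seg m 0 (len m) \<frown> R')"
    unfolding step(1) e j by simp
  then have "(\<exists>k\<in>{0<..len m}. R = seg m 0 k) \<or>
    (\<exists>R'. is_path G BranchT w R' \<and> pedges R' \<noteq> [] \<and> R = seg m 0 (len m) \<frown> R')"
    unfolding Bex_def greaterThanAtMost_iff by blast
  then show ?thesis
    using m(1) by blast
qed

text \<open>Used for the last part of a path that has already passed the other branch vertex.\<close>

lemma path_from_T_avoiding_S:
  assumes "is_path G BranchT w R" "pedges R \<noteq> []" "BranchS \<notin> set (pverts R)"
  shows "\<exists>m<3. \<exists>k\<in>{0<..<len m}. R = seg m (len m) k"
proof -
  obtain m where m: "m < 3" "(\<exists>k<len m. R = seg m (len m) k) \<or>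
    (\<exists>R'. is_path G BranchS w R' \<and> pedges R' \<noteq> [] \<and> R = seg m (len m) 0 \<frown> R')"
    using path_from_T[OF assms(1,2)] by blast
  have S: "BranchS \<in> set (pverts (seg m j 0))" for j
    using last_in_set[of "pverts (seg m j 0)"] by simp
  from m(2) show ?thesis
  proof (elim disjE exE conjE)
    fix k assume "k < len m" and R: "R = seg m (len m) k"
    moreover have "k \<noteq> 0"
      using S assms(3) R by metis
    ultimately have "k \<in> {0<..<len m}"
      by simp
    then show ?thesis
      using m(1) R by blast
  next
    fix R' assume "R = seg m (len m) 0 \<frown> R'"
    then show ?thesis
      using S assms(3) by (simp add: join_def)
  qed
qed

lemma path_from_S_avoiding_T:
  assumes "is_path G BranchS w R" "pedges R \<noteq> []" "BranchT \<notin> set (pverts R)"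
  shows "\<exists>m<3. \<exists>k\<in>{0<..<len m}. R = seg m 0 k"
proof -
  obtain m where m: "m < 3" "(\<exists>k\<in>{0<..len m}. R = seg m 0 k) \<or>
    (\<exists>R'. is_path G BranchT w R' \<and> pedges R' \<noteq> [] \<and> R = seg m 0 (len m) \<frown> R')"
    using path_from_S[OF assms(1,2)] by blast
  have T: "BranchT \<in> set (pverts (seg m j (len m)))" for j
    using last_in_set[of "pverts (seg m j (len m))"] m(1) by simp
  from m(2) show ?thesis
  proof (elim disjE exE conjE bexE)
    fix k assume "k \<in> {0<..len m}" and R: "R = seg m 0 k"
    moreover have "k \<noteq> len m"
      using T assms(3) R by metis
    ultimately have "k \<in> {0<..<len m}"
      by simp
    then show ?thesis
      using m(1) R by blast
  next
    fix R' assume "R = seg m 0 (len m) \<frown> R'"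
    then show ?thesis
      using T assms(3) by (simp add: join_def)
  qed
qed

text \<open>From \<open>BranchT\<close> a path may pass \<open>BranchS\<close>, but it cannot pass \<open>BranchT\<close> again.\<close>

lemma path_from_T_forms:
  assumes "is_path G BranchT w R" "pedges R \<noteq> []"
  shows "(\<exists>m<3. \<exists>k<len m. R = seg m (len m) k) \<or>
    (\<exists>m<3. \<exists>n<3. \<exists>k\<in>{0<..<len n}. R = seg m (len m) 0 \<frown> seg n 0 k)"
proof -
  obtain m where m: "m < 3" "(\<exists>k<len m. R = seg m (len m) k) \<or>
    (\<exists>R'. is_path G BranchS w R' \<and> pedges R' \<noteq> [] \<and> R = seg m (len m) 0 \<frown> R')"
    using path_from_T[OF assms] by blast
  from m(2) show ?thesis
  proof (elim disjE exE conjE)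
    fix R' assume R': "is_path G BranchS w R'" "pedges R' \<noteq> []" and R: "R = seg m (len m) 0 \<frown> R'"
    have "BranchT \<in> set (pverts (seg m (len m) 0))"
      using hd_in_set[of "pverts (seg m (len m) 0)"] m(1) by simp
    then have "BranchT \<notin> set (pverts R')"
      using join_common_vertex[of "seg m (len m) 0" R' BranchT] distinct_path[OF assms(1)]
        hd_pverts_path[OF R'(1)] R by auto
    then show ?thesis
      using path_from_S_avoiding_T[OF R'] R m(1) by blast
  qed (use m in blast)
qed

lemma path_from_S_forms:
  assumes "is_path G BranchS w R" "pedges R \<noteq> []"
  shows "(\<exists>m<3. \<exists>k\<in>{0<..len m}. R = seg m 0 k) \<or>
    (\<exists>m<3. \<exists>n<3. \<exists>k\<in>{0<..<len n}. R = seg m 0 (len m) \<frown> seg n (len n) k)"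
proof -
  obtain m where m: "m < 3" "(\<exists>k\<in>{0<..len m}. R = seg m 0 k) \<or>
    (\<exists>R'. is_path G BranchT w R' \<and> pedges R' \<noteq> [] \<and> R = seg m 0 (len m) \<frown> R')"
    using path_from_S[OF assms] by blast
  from m(2) show ?thesis
  proof (elim disjE exE conjE bexE)
    fix R' assume R': "is_path G BranchT w R'" "pedges R' \<noteq> []" and R: "R = seg m 0 (len m) \<frown> R'"
    have "BranchS \<in> set (pverts (seg m 0 (len m)))"
      using hd_in_set[of "pverts (seg m 0 (len m))"] m(1) by simp
    then have "BranchS \<notin> set (pverts R')"
      using join_common_vertex[of "seg m 0 (len m)" R' BranchS] distinct_path[OF assms(1)]
        hd_pverts_path[OF R'(1)] R by auto
    then show ?thesis
      using path_from_T_avoiding_S[OF R'] R m(1) by blast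
  qed (use m in blast)
qed

text \<open>A path is cut by the branch vertices into at most three segments of arms. Segments of length 0 are
admitted, so that the same five forms cover the paths that start at a branch vertex.\<close>

lemma path_forms:
  assumes "is_path G (vx i j) w Q" "i < 3" "j \<le> len i" "pedges Q \<noteq> []"
  shows "(\<exists>k\<le>len i. Q = seg i j k)
    \<or> (\<exists>m<3. \<exists>k<len m. Q = seg i j (len i) \<frown> seg m (len m) k)
    \<or> (\<exists>m<3. \<exists>n<3. \<exists>k\<in>{0<..<len n}. Q = seg i j (len i) \<frown> seg m (len m) 0 \<frown> seg n 0 k)
    \<or> (\<exists>m<3. \<exists>k\<in>{0<..len m}. Q = seg i j 0 \<frown> seg m 0 k)
    \<or> (\<exists>m<3. \<exists>n<3. \<exists>k\<in>{0<..<len n}. Q = seg i j 0 \<frown> seg m 0 (len m) \<frown> seg n (len n) k)"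
proof -
  have triv: "seg i j j \<frown> Q = Q"
    using join_trivial[of Q] hd_pverts_path[OF assms(1)] pverts_path_nonempty[OF assms(1)]
    by (simp add: leg_refl)
  consider "j = 0" | "j = len i" | "0 < j" "j < len i"
    using assms(3) by linarith
  then show ?thesis
  proof cases
    case 1
    then have "is_path G BranchS w Q"
      using assms(1) by simp
    from path_from_S_forms[OF this assms(4)] show ?thesis
    proof (elim disjE exE conjE bexE)
      fix m k assume "m < 3" "k \<in> {0<..len m}" and Q: "Q = seg m 0 k"
      moreover have "Q = seg i j 0 \<frown> seg m 0 k"
        using triv unfolding Q 1 by simp
      ultimately show ?thesis
        by blast
    next
      fix m n k assume "m < 3" "n < 3" "k \<in> {0<..<len n}" and Q: "Q = seg m 0 (len m) \<frown> seg n (len n) k"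
      moreover have "Q = seg i j 0 \<frown> seg m 0 (len m) \<frown> seg n (len n) k"
        using triv unfolding Q 1 by simp
      ultimately show ?thesis
        by blast
    qed
  next
    case 2
    then have "is_path G BranchT w Q"
      using assms(1,2) by simp
    from path_from_T_forms[OF this assms(4)] show ?thesis
    proof (elim disjE exE conjE bexE)
      fix m k assume "m < 3" "k < len m" and Q: "Q = seg m (len m) k"
      moreover have "Q = seg i j (len i) \<frown> seg m (len m) k"
        using triv unfolding Q 2 by simp
      ultimately show ?thesis
        by blast
    next
      fix m n k assume "m < 3" "n < 3" "k \<in> {0<..<len n}" and Q: "Q = seg m (len m) 0 \<frown> seg n 0 k"
      moreover have "Q = seg i j (len i) \<frown> seg m (len m) 0 \<frown> seg n 0 k"
        using triv unfolding Q 2 by simp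
      ultimately show ?thesis
        by blast
    qed
  next
    case 3
    show ?thesis
      using assms(1)
    proof (cases rule: is_path_cases)
      case trivial
      then show ?thesis
        using assms(4) by simp
    next
      case (step y vs e es)
      obtain i' j' where e: "e = (i', j')"
        by (cases e)
      then have e': "i' < 3" "j' < len i'"
        using step(4) by (auto simp: edges_G)
      have "Inner i j \<in> {vx i' j', vx i' (Suc j')}"
        using step(5) 3 by (simp add: e ends_G vx_inner)
      then have i': "i' = i" "j' = j \<or> Suc j' = j"
        using e' by (auto simp: arm_vertex_def split: if_splits)
      from i'(2) show ?thesis
      proof
        assume "j' = j"
        then have "is_path G (vx i j) w (Path (vx i j # y # vs) ((i, j) # es))"
          using assms(1) unfolding step(1) e i'(1) by simp
        from path_up[OF assms(2) 3(2) this] \<open>j' = j\<close>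
        consider k where "k \<le> len i" "Q = seg i j k"
          | R where "is_path G BranchT w R" "pedges R \<noteq> []" "Q = seg i j (len i) \<frown> R"
          unfolding step(1) e i'(1) by blast
        then show ?thesis
        proof cases
          case (2 R)
          show ?thesis
            using path_from_T_forms[OF 2(1,2)] unfolding 2(3) by blast
        qed blast
      next
        assume j': "Suc j' = j"
        then have "is_path G (vx i (Suc j')) w (Path (vx i (Suc j') # y # vs) ((i, j') # es))"
          using assms(1) unfolding step(1) e i'(1) by simp
        from path_down[OF assms(2) _ this] 3 j'
        consider k where "k \<le> j'" "Q = seg i j k"
          | R where "is_path G BranchS w R" "pedges R \<noteq> []" "Q = seg i j 0 \<frown> R"
          unfolding step(1) e i'(1) by (metis Suc_lessD)
        then show ?thesis
        proof cases
          case (1 k)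
          then have "k \<le> len i"
            using 3 j' by simp
          then show ?thesis
            using 1(2) by blast
        next
          case (2 R)
          show ?thesis
            using path_from_S_forms[OF 2(1,2)] unfolding 2(3) by blast
        qed
      qed
    qed
  qed
qed

lemma vx_in_seg:
  "min j k \<le> p \<Longrightarrow> p \<le> max j k \<Longrightarrow> vx i p \<in> set (pverts (seg i j k))"
  by (simp add: set_leg)

text \<open>Since the vertices of a path are distinct, a path that does not run directly along the arm must start
towards \<open>BranchS\<close>, traverse another arm completely and return to the arm from \<open>BranchT\<close>.\<close>

lemma same_arm_path:
  assumes Q: "is_path G (vx i j) (vx i k) Q" and i: "i < 3" and jk: "j < k" "k \<le> len i"
  shows "Q = seg i j k \<or>
    (\<exists>m<3. m \<noteq> i \<and> Q = seg i j 0 \<frown> seg m 0 (len m) \<frown> seg i (len i) k)"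
proof -
  have "pedges Q \<noteq> []"
    using trivial_path[OF Q] i jk by (auto simp: vx_eq_iff)
  note forms = path_forms[OF Q i _ this]
  note dist = distinct_path[OF Q] and last = last_pverts_path[OF Q]
  have j: "j \<le> len i"
    using jk by simp
  from forms[OF j] show ?thesis
  proof (elim disjE exE conjE bexE)
    fix k' assume "k' \<le> len i" "Q = seg i j k'"
    then show ?thesis
      using last i jk by (auto simp: vx_eq_iff)
  next
    fix m k' assume m: "m < 3" "k' < len m" and eq: "Q = seg i j (len i) \<frown> seg m (len m) k'"
    have "vx m k' = vx i k"
      using last m i by (simp add: eq last_pverts_join)
    then have "m = i" "k' = k"
      using m i jk by (auto simp: vx_eq_iff)
    then have "vx i k = BranchT"
      using join_common_vertex[of "seg i j (len i)" "seg m (len m) k'" "vx i k"] dist eq i jk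
      by (auto simp: vx_in_seg)
    then show ?thesis
      using vx_eq_iff[of i i k "len i"] i m jk \<open>m = i\<close> \<open>k' = k\<close> by simp
  next
    fix m n k' assume m: "m < 3" "n < 3" "k' \<in> {0<..<len n}"
      and eq: "Q = seg i j (len i) \<frown> seg m (len m) 0 \<frown> seg n 0 k'"
    have "vx n k' = vx i k"
      using last m i by (simp add: eq last_pverts_join)
    then have n: "n = i" "k' = k"
      using m i jk by (auto simp: vx_eq_iff)
    then have "vx i k = BranchT"
      using join_common_vertex[of "seg i j (len i)" "seg m (len m) 0 \<frown> seg n 0 k'" "vx i k"] dist eq i jk m
      by (auto simp: vx_in_seg set_pverts_join)
    then show ?thesis
      using vx_eq_iff[of i i k "len i"] i m jk n by simp
  next
    fix m k' assume m: "m < 3" "k' \<in> {0<..len m}" and eq: "Q = seg i j 0 \<frown> seg m 0 k'"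
    have "vx m k' = vx i k"
      using last m i by (simp add: eq last_pverts_join)
    then consider "m = i" "k' = k" | "m \<noteq> i" "k' = len m" "k = len i"
      using m i jk by (auto simp: vx_eq_iff)
    then show ?thesis
    proof cases
      case 1
      then have "vx i j = BranchS"
        using join_common_vertex[of "seg i j 0" "seg m 0 k'" "vx i j"] dist eq i jk
        by (auto simp: vx_in_seg)
      then have "j = 0"
        using vx_eq_iff[of i i j 0] i jk by simp
      then have "Q = seg i j k"
        using eq 1 leg_split_up[of 0 0 k "len i" i] by simp
      then show ?thesis
        by blast
    next
      case 2
      then have "Q = seg i j 0 \<frown> seg m 0 (len m) \<frown> seg i (len i) k"
        by (simp add: eq)
      then show ?thesis
        using 2 m(1) by blast
    qed
  next
    fix m n k' assume m: "m < 3" "n < 3" "k' \<in> {0<..<len n}"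
      and eq: "Q = seg i j 0 \<frown> seg m 0 (len m) \<frown> seg n (len n) k'"
    have "vx n k' = vx i k"
      using last m i by (simp add: eq last_pverts_join)
    then have n: "n = i" "k' = k"
      using m i jk by (auto simp: vx_eq_iff)
    have "distinct (pverts (seg m 0 (len m) \<frown> seg n (len n) k'))"
      using dist eq distinct_join_right[of "seg i j 0"] by simp
    then have "m \<noteq> i"
      using join_common_vertex[of "seg m 0 (len m)" "seg n (len n) k'" "vx i k"] n m i jk
        vx_eq_iff[of i i k "len i"]
      by (auto simp: vx_in_seg)
    then show ?thesis
      using eq n m by blast
  qed
qed

text \<open>Distinctness of the vertices leaves four of the forms of \<open>path_forms\<close>: the first segment leads to
either branch vertex, and the third arm may or may not be traversed.\<close>

lemma cross_arm_path:
  assumes Q: "is_path G (vx i j) (vx i' k) Q" and i: "i < 3" "i' < 3" "i \<noteq> i'"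
    and jk: "0 < j" "j < len i" "0 < k" "k < len i'"
  shows "Q = seg i j 0 \<frown> seg i' 0 k \<or> Q = seg i j (len i) \<frown> seg i' (len i') k \<or>
    (\<exists>m<3. m \<noteq> i \<and> m \<noteq> i' \<and>
      (Q = seg i j 0 \<frown> seg m 0 (len m) \<frown> seg i' (len i') k \<or>
       Q = seg i j (len i) \<frown> seg m (len m) 0 \<frown> seg i' 0 k))"
proof -
  have "pedges Q \<noteq> []"
    using trivial_path[OF Q] i jk by (auto simp: vx_eq_iff)
  note forms = path_forms[OF Q i(1) _ this]
  note dist = distinct_path[OF Q] and last = last_pverts_path[OF Q]
  have j: "j \<le> len i"
    using jk by simp
  have not_S: "vx i j \<noteq> BranchS" "vx i' k \<noteq> BranchS" and not_T: "vx i j \<noteq> BranchT" "vx i' k \<noteq> BranchT"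
    using jk by (simp_all add: vx_inner)
  from forms[OF j] show ?thesis
  proof (elim disjE exE conjE bexE)
    fix k' assume "k' \<le> len i" "Q = seg i j k'"
    then show ?thesis
      using last i jk by (auto simp: vx_eq_iff)
  next
    fix m k' assume m: "m < 3" "k' < len m" and eq: "Q = seg i j (len i) \<frown> seg m (len m) k'"
    have "vx m k' = vx i' k"
      using last m i by (simp add: eq last_pverts_join)
    then have "m = i'" "k' = k"
      using m i jk by (auto simp: vx_eq_iff)
    then show ?thesis
      using eq by simp
  next
    fix m n k' assume m: "m < 3" "n < 3" "k' \<in> {0<..<len n}"
      and eq: "Q = seg i j (len i) \<frown> seg m (len m) 0 \<frown> seg n 0 k'"
    have "vx n k' = vx i' k"
      using last m i by (simp add: eq last_pverts_join)
    then have n: "n = i'" "k' = k"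
      using m i jk by (auto simp: vx_eq_iff)
    have "m \<noteq> i"
      using join_common_vertex[of "seg i j (len i)" "seg m (len m) 0 \<frown> seg n 0 k'" "vx i j"] dist eq i jk m not_T
      by (auto simp: vx_in_seg set_pverts_join)
    moreover have "distinct (pverts (seg m (len m) 0 \<frown> seg n 0 k'))"
      using dist eq distinct_join_right[of "seg i j (len i)"] i m by simp
    then have "m \<noteq> i'"
      using join_common_vertex[of "seg m (len m) 0" "seg n 0 k'" "vx i' k"] n m i jk not_S
      by (auto simp: vx_in_seg)
    ultimately show ?thesis
      using eq n m by blast
  next
    fix m k' assume m: "m < 3" "k' \<in> {0<..len m}" and eq: "Q = seg i j 0 \<frown> seg m 0 k'"
    have "vx m k' = vx i' k"
      using last m i by (simp add: eq last_pverts_join)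
    then have "m = i'" "k' = k"
      using m i jk by (auto simp: vx_eq_iff)
    then show ?thesis
      using eq by simp
  next
    fix m n k' assume m: "m < 3" "n < 3" "k' \<in> {0<..<len n}"
      and eq: "Q = seg i j 0 \<frown> seg m 0 (len m) \<frown> seg n (len n) k'"
    have "vx n k' = vx i' k"
      using last m i by (simp add: eq last_pverts_join)
    then have n: "n = i'" "k' = k"
      using m i jk by (auto simp: vx_eq_iff)
    have "m \<noteq> i"
      using join_common_vertex[of "seg i j 0" "seg m 0 (len m) \<frown> seg n (len n) k'" "vx i j"] dist eq i jk m not_S
      by (auto simp: vx_in_seg set_pverts_join)
    moreover have "distinct (pverts (seg m 0 (len m) \<frown> seg n (len n) k'))"
      using dist eq distinct_join_right[of "seg i j 0"] i m by simp
    then have "m \<noteq> i'"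
      using join_common_vertex[of "seg m 0 (len m)" "seg n (len n) k'" "vx i' k"] n m i jk not_T
      by (auto simp: vx_in_seg)
    ultimately show ?thesis
      using eq n m by blast
  qed
qed

lemma weight_via_S:
  assumes "i \<noteq> i'"
  shows "path_weight w (seg i j 0 \<frown> seg i' 0 k) = arm_dist w i j + arm_dist w i' k"
  using assms by (subst path_weight_join) (auto simp: pedges_leg path_weight_leg_up path_weight_leg_down)

lemma weight_via_T:
  assumes "i \<noteq> i'" "j \<le> len i" "k \<le> len i'"
  shows "path_weight w (seg i j (len i) \<frown> seg i' (len i') k) =
    (arm_dist w i (len i) - arm_dist w i j) + (arm_dist w i' (len i') - arm_dist w i' k)"
  using assms by (subst path_weight_join) (auto simp: pedges_leg path_weight_leg_up path_weight_leg_down)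

lemma weight_via_ST:
  assumes "m \<noteq> i" "m \<noteq> i'" "i = i' \<Longrightarrow> j \<le> k" "k \<le> len i'"
  shows "path_weight w (seg i j 0 \<frown> seg m 0 (len m) \<frown> seg i' (len i') k) =
    arm_dist w i j + arm_dist w m (len m) + (arm_dist w i' (len i') - arm_dist w i' k)"
proof -
  have "set (pedges (seg i j 0)) \<inter> set (pedges (seg m 0 (len m) \<frown> seg i' (len i') k)) = {}"
    using assms by (auto simp: pedges_leg join_def)
  moreover have "set (pedges (seg m 0 (len m))) \<inter> set (pedges (seg i' (len i') k)) = {}"
    using assms by (auto simp: pedges_leg)
  ultimately show ?thesis
    using assms by (simp add: path_weight_join path_weight_leg_up path_weight_leg_down)
qed

lemma weight_via_TS:
  assumes "m \<noteq> i" "m \<noteq> i'" "i \<noteq> i'" "j \<le> len i"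
  shows "path_weight w (seg i j (len i) \<frown> seg m (len m) 0 \<frown> seg i' 0 k) =
    (arm_dist w i (len i) - arm_dist w i j) + arm_dist w m (len m) + arm_dist w i' k"
proof -
  have "set (pedges (seg i j (len i))) \<inter> set (pedges (seg m (len m) 0 \<frown> seg i' 0 k)) = {}"
    using assms by (auto simp: pedges_leg join_def)
  moreover have "set (pedges (seg m (len m) 0)) \<inter> set (pedges (seg i' 0 k)) = {}"
    using assms by (auto simp: pedges_leg)
  ultimately show ?thesis
    using assms by (simp add: path_weight_join path_weight_leg_up path_weight_leg_down)
qed

end

section \<open>Consistent path systems of a theta graph\<close>

locale theta_path_system = theta_arms +
  fixes P :: "theta_vertex \<Rightarrow> theta_vertex \<Rightarrow> (theta_vertex, nat \<times> nat) path"
  assumes system: "path_system G P" and consistent: "consistent G P"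
begin

definition direct :: "nat \<Rightarrow> nat \<Rightarrow> nat \<Rightarrow> bool" where
  "direct i j k \<longleftrightarrow> P (vx i j) (vx i k) = seg i j k"

definition via_S :: "nat \<Rightarrow> nat \<Rightarrow> nat \<Rightarrow> nat \<Rightarrow> bool" where
  "via_S i j i' k \<longleftrightarrow> P (vx i j) (vx i' k) = seg i j 0 \<frown> seg i' 0 k"

text \<open>Normal vertices are those whose potential will have to lie between \<open>- h X 0\<close> and \<open>h X 0\<close>. Only
between two normal vertices of different arms are the path through \<open>BranchS\<close> and the path through
\<open>BranchT\<close> both compatible with the paths to the branch vertices.\<close>

definition normal :: "nat \<Rightarrow> nat \<Rightarrow> bool" where
  "normal i j \<longleftrightarrow> direct i 0 j \<and> direct i j (len i)"

lemma P_path: "u \<in> verts G \<Longrightarrow> v \<in> verts G \<Longrightarrow> u \<noteq> v \<Longrightarrow> is_path G u v (P u v)"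
  using system unfolding path_system_def by blast

lemma P_rev: "u \<in> verts G \<Longrightarrow> v \<in> verts G \<Longrightarrow> u \<noteq> v \<Longrightarrow> P v u = rev_path (P u v)"
  using system unfolding path_system_def by blast

lemma P_prefix:
  assumes "P u v = Q \<frown> R" "u \<in> verts G" "v \<in> verts G" "u \<noteq> v"
    "wf_path Q" "wf_path R" "pedges Q \<noteq> []"
  shows "P u (last (pverts Q)) = Q"
  by (rule consistent_prefix[OF consistent assms(2-4) P_path[OF assms(2-4)] assms(1,5-7)])

lemma P_suffix:
  assumes "P u v = Q \<frown> R" "u \<in> verts G" "v \<in> verts G" "u \<noteq> v"
    "wf_path Q" "wf_path R" "pedges R \<noteq> []" "last (pverts Q) = hd (pverts R)"
  shows "P (hd (pverts R)) v = R"
  by (rule consistent_suffix[OF consistent assms(2-4) P_path[OF assms(2-4)] assms(1,5-8)])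

lemma S_T_in_G [simp]: "BranchS \<in> verts G" "BranchT \<in> verts G"
  using vx_in_G[of 0 0] vx_in_G[of 0 "len 0"] by simp_all

lemma direct_rev:
  assumes "i < 3" "j < k" "k \<le> len i"
  shows "direct i k j \<longleftrightarrow> direct i j k"
proof -
  have "vx i j \<noteq> vx i k"
    using assms by (simp add: vx_eq_iff)
  then have "P (vx i k) (vx i j) = rev_path (P (vx i j) (vx i k))"
    using assms by (intro P_rev) auto
  moreover have "rev_path Q = seg i k j \<longleftrightarrow> Q = seg i j k" for Q
    using rev_path_inject[of Q "seg i j k"] by simp
  ultimately show ?thesis
    by (simp add: direct_def)
qed

lemma direct_mono:
  assumes "direct i j k" "i < 3" "j \<le> j'" "j' < k'" "k' \<le> k" "k \<le> len i"
  shows "direct i j' k'"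
proof -
  have "P (vx i j) (vx i k) = seg i j k' \<frown> seg i k' k"
    using assms by (simp add: direct_def leg_split_up[of j k' k])
  then have "P (vx i j) (vx i k') = seg i j k'"
    using P_prefix[of "vx i j" "vx i k" "seg i j k'" "seg i k' k"] assms by (simp add: vx_eq_iff)
  then have "P (vx i j) (vx i k') = seg i j j' \<frown> seg i j' k'"
    using assms by (simp add: leg_split_up[of j j' k'])
  then show ?thesis
    using P_suffix[of "vx i j" "vx i k'" "seg i j j'" "seg i j' k'"] assms by (simp add: vx_eq_iff direct_def)
qed

text \<open>A system path between two vertices of an arm that is not the direct one contains a whole arm. By
consistency that arm is the system path between the branch vertices, and the two ends of the detour
are system paths as well.\<close>

lemma detour:
  assumes "\<not> direct i j k" "i < 3" "j < k" "k \<le> len i"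
  obtains m where "m < 3" "m \<noteq> i" "direct m 0 (len m)"
    "P (vx i j) (vx i k) = seg i j 0 \<frown> seg m 0 (len m) \<frown> seg i (len i) k"
    "0 < j \<Longrightarrow> direct i 0 j" "k < len i \<Longrightarrow> direct i k (len i)"
proof -
  have ne: "vx i j \<noteq> vx i k"
    using assms by (simp add: vx_eq_iff)
  then have "is_path G (vx i j) (vx i k) (P (vx i j) (vx i k))"
    using P_path assms by simp
  from same_arm_path[OF this assms(2-4)] obtain m where m: "m < 3" "m \<noteq> i"
    and eq: "P (vx i j) (vx i k) = seg i j 0 \<frown> seg m 0 (len m) \<frown> seg i (len i) k"
    using assms(1) by (auto simp: direct_def)
  have "pverts (seg m 0 (len m) \<frown> seg i (len i) k) \<noteq> []" "pedges (seg m 0 (len m) \<frown> seg i (len i) k) \<noteq> []"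
    using m by (simp_all add: join_def)
  then have "P BranchS (vx i k) = seg m 0 (len m) \<frown> seg i (len i) k"
    using P_suffix[OF eq] ne assms by simp
  moreover have "BranchS \<noteq> vx i k"
    using assms vx_eq_iff[of i i 0 k] by simp
  ultimately have "P BranchS BranchT = seg m 0 (len m)"
    using P_prefix[of BranchS "vx i k" "seg m 0 (len m)" "seg i (len i) k"] m assms by simp
  then have "direct m 0 (len m)"
    using m by (simp add: direct_def)
  moreover have "direct i 0 j" if "0 < j"
    using P_prefix[OF eq] ne assms that direct_rev[of i 0 j] by (simp add: direct_def)
  moreover have "direct i k (len i)" if "k < len i"
  proof -
    have "P (vx i j) (vx i k) = (seg i j 0 \<frown> seg m 0 (len m)) \<frown> seg i (len i) k"
      using eq by (simp add: join_assoc)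
    from P_suffix[OF this] have "P BranchT (vx i k) = seg i (len i) k"
      using ne assms m that by (simp add: last_pverts_join)
    then show ?thesis
      using direct_rev[of i k "len i"] that assms by (simp add: direct_def)
  qed
  ultimately show ?thesis
    using that m eq by blast
qed

lemma ex_direct_arm: "\<exists>X<3. direct X 0 (len X)"
proof (cases "direct 0 0 (len 0)")
  case False
  then show ?thesis
    using detour[OF False] by (metis le_refl len_pos zero_less_numeral)
next
  case True
  then show ?thesis
    by (intro exI[of _ 0]) simp
qed

lemma vx_neq_cross:
  assumes "i < 3" "i' < 3" "i \<noteq> i'" "0 < j" "j < len i" "k \<le> len i'"
  shows "vx i j \<noteq> vx i' k"
  using assms by (simp add: vx_eq_iff)

lemma via_S_commute:
  assumes "i < 3" "i' < 3" "i \<noteq> i'" "0 < j" "j < len i" "k \<le> len i'"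
  shows "via_S i j i' k \<longleftrightarrow> via_S i' k i j"
proof -
  have ne: "vx i j \<noteq> vx i' k"
    using vx_neq_cross[OF assms] .
  have "P (vx i' k) (vx i j) = rev_path (P (vx i j) (vx i' k))"
    using ne assms by (intro P_rev) auto
  moreover have "rev_path (seg i j 0 \<frown> seg i' 0 k) = seg i' k 0 \<frown> seg i 0 j"
    by (simp add: rev_path_join)
  then have "rev_path Q = seg i' k 0 \<frown> seg i 0 j \<longleftrightarrow> Q = seg i j 0 \<frown> seg i' 0 k" for Q
    using rev_path_inject[of Q "seg i j 0 \<frown> seg i' 0 k"] by simp
  ultimately show ?thesis
    by (simp add: via_S_def)
qed

lemma via_S_direct:
  assumes "via_S i j i' k" "i < 3" "i' < 3" "i \<noteq> i'" "0 < j" "j < len i" "0 < k" "k < len i'"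
  shows "direct i 0 j" "direct i' 0 k"
proof -
  have eq: "P (vx i j) (vx i' k) = seg i j 0 \<frown> seg i' 0 k"
    using assms(1) by (simp add: via_S_def)
  have ne: "vx i j \<noteq> vx i' k"
    using vx_neq_cross assms by simp
  show "direct i 0 j"
    using P_prefix[OF eq] ne assms direct_rev[of i 0 j] by (simp add: direct_def)
  show "direct i' 0 k"
    using P_suffix[OF eq] ne assms by (simp add: direct_def)
qed

text \<open>The path through \<open>BranchS\<close> contains the corresponding paths between vertices closer to \<open>BranchS\<close>,
so these pairs are joined through \<open>BranchS\<close> too.\<close>

lemma via_S_mono:
  assumes "via_S i j i' k" "i < 3" "i' < 3" "i \<noteq> i'" "j < len i" "k < len i'"
    "0 < j'" "j' \<le> j" "0 < k'" "k' \<le> k"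
  shows "via_S i j' i' k'"
proof -
  have "P (vx i j) (vx i' k) = seg i j j' \<frown> seg i j' 0 \<frown> seg i' 0 k"
    using assms by (simp add: via_S_def leg_split_down[of 0 j' j] join_assoc)
  from P_suffix[OF this] have "P (vx i j') (vx i' k) = seg i j' 0 \<frown> seg i' 0 k"
    using assms by (simp add: vx_neq_cross) (simp add: join_def)
  then have eq: "P (vx i j') (vx i' k) = (seg i j' 0 \<frown> seg i' 0 k') \<frown> seg i' k' k"
    using assms by (simp add: leg_split_up[of 0 k' k] join_assoc)
  have "pedges (seg i j' 0 \<frown> seg i' 0 k') \<noteq> []"
    using assms by (simp add: join_def)
  then show ?thesis
    using P_prefix[OF eq] assms by (simp add: vx_neq_cross via_S_def last_pverts_join)
qed

text \<open>For the last claim, the paths through \<open>BranchT\<close> and through \<open>BranchS\<close> differ in their first edge.\<close>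

lemma via_T_direct:
  assumes "P (vx i j) (vx i' k) = seg i j (len i) \<frown> seg i' (len i') k"
    "i < 3" "i' < 3" "i \<noteq> i'" "0 < j" "j < len i" "0 < k" "k < len i'"
  shows "direct i j (len i)" "direct i' k (len i')" "\<not> via_S i j i' k"
proof -
  have ne: "vx i j \<noteq> vx i' k"
    using vx_neq_cross assms by simp
  show "direct i j (len i)"
    using P_prefix[OF assms(1)] ne assms by (simp add: direct_def)
  show "direct i' k (len i')"
    using P_suffix[OF assms(1)] ne assms direct_rev[of i' k "len i'"] by (simp add: direct_def)
  have "hd (pedges (seg i j (len i) \<frown> seg i' (len i') k)) \<noteq> hd (pedges (seg i j 0 \<frown> seg i' 0 k))"
    using assms by (simp add: join_def hd_pedges_leg)
  then show "\<not> via_S i j i' k"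
    unfolding via_S_def assms(1) by metis
qed

text \<open>The path contains the system paths from its first vertex to \<open>BranchT\<close> and from \<open>BranchS\<close> to its
last vertex, and both of them leave the arm.\<close>

lemma via_ST_not_direct:
  assumes "P (vx i j) (vx i' k) = seg i j 0 \<frown> seg m 0 (len m) \<frown> seg i' (len i') k"
    "i < 3" "i' < 3" "i \<noteq> i'" "0 < j" "j < len i" "0 < k" "k < len i'" "m < 3" "m \<noteq> i'"
  shows "direct m 0 (len m)" "\<not> direct i j (len i)" "\<not> direct i' 0 k"
proof -
  have ne: "vx i j \<noteq> vx i' k"
    using vx_neq_cross assms by simp
  have nt: "vx i j \<noteq> BranchT"
    using assms by (simp add: vx_inner)
  have "P (vx i j) (vx i' k) = (seg i j 0 \<frown> seg m 0 (len m)) \<frown> seg i' (len i') k"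
    using assms(1) by (simp add: join_assoc)
  moreover have "pedges (seg i j 0 \<frown> seg m 0 (len m)) \<noteq> []"
    using assms by (simp add: join_def)
  ultimately have eq: "P (vx i j) BranchT = seg i j 0 \<frown> seg m 0 (len m)"
    using P_prefix[of "vx i j" "vx i' k" "seg i j 0 \<frown> seg m 0 (len m)"] ne assms
    by (simp add: last_pverts_join)
  from P_suffix[OF this] show "direct m 0 (len m)"
    using assms nt by (simp add: direct_def)
  have "hd (pedges (seg i j 0 \<frown> seg m 0 (len m))) \<noteq> hd (pedges (seg i j (len i)))"
    using assms by (simp add: join_def hd_pedges_leg)
  then show "\<not> direct i j (len i)"
    using eq assms unfolding direct_def by auto
  have "pedges (seg m 0 (len m) \<frown> seg i' (len i') k) \<noteq> []"
    using assms by (simp add: join_def)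
  then have "P BranchS (vx i' k) = seg m 0 (len m) \<frown> seg i' (len i') k"
    using P_suffix[OF assms(1)] ne assms by simp
  moreover have "hd (pedges (seg m 0 (len m) \<frown> seg i' (len i') k)) \<noteq> hd (pedges (seg i' 0 k))"
    using assms by (simp add: join_def hd_pedges_leg)
  ultimately show "\<not> direct i' 0 k"
    unfolding direct_def by auto
qed

lemma via_TS_not_direct:
  assumes "P (vx i j) (vx i' k) = seg i j (len i) \<frown> seg m (len m) 0 \<frown> seg i' 0 k"
    "i < 3" "i' < 3" "i \<noteq> i'" "0 < j" "j < len i" "0 < k" "k < len i'" "m < 3" "m \<noteq> i"
  shows "direct m 0 (len m)" "\<not> direct i 0 j" "\<not> direct i' k (len i')"
proof -
  have "P (vx i' k) (vx i j) = rev_path (P (vx i j) (vx i' k))"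
    using vx_neq_cross assms by (intro P_rev) simp_all
  also have "\<dots> = seg i' k 0 \<frown> seg m 0 (len m) \<frown> seg i (len i) j"
    using assms by (simp add: rev_path_join join_assoc)
  finally show "direct m 0 (len m)" "\<not> direct i 0 j" "\<not> direct i' k (len i')"
    using via_ST_not_direct[of i' k i j m] assms by auto
qed

text \<open>Which of the four possible paths occurs is determined by how the two vertices are joined to the
branch vertices, except for the choice between the first two when both vertices are normal.\<close>

lemma cross_arm_system_path:
  assumes "i < 3" "i' < 3" "i \<noteq> i'" "0 < j" "j < len i" "0 < k" "k < len i'"
  obtains (S) "via_S i j i' k" "P (vx i j) (vx i' k) = seg i j 0 \<frown> seg i' 0 k" "direct i 0 j" "direct i' 0 k"
  | (T) "\<not> via_S i j i' k" "P (vx i j) (vx i' k) = seg i j (len i) \<frown> seg i' (len i') k"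
      "direct i j (len i)" "direct i' k (len i')"
  | (ST) m where "m < 3" "m \<noteq> i" "m \<noteq> i'" "direct m 0 (len m)"
      "P (vx i j) (vx i' k) = seg i j 0 \<frown> seg m 0 (len m) \<frown> seg i' (len i') k"
      "\<not> direct i j (len i)" "\<not> direct i' 0 k"
  | (TS) m where "m < 3" "m \<noteq> i" "m \<noteq> i'" "direct m 0 (len m)"
      "P (vx i j) (vx i' k) = seg i j (len i) \<frown> seg m (len m) 0 \<frown> seg i' 0 k"
      "\<not> direct i 0 j" "\<not> direct i' k (len i')"
proof -
  have "is_path G (vx i j) (vx i' k) (P (vx i j) (vx i' k))"
    using P_path vx_neq_cross assms by simp
  from cross_arm_path[OF this assms] show ?thesis
  proof (elim disjE exE conjE)
    assume "P (vx i j) (vx i' k) = seg i j 0 \<frown> seg i' 0 k"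
    then show ?thesis
      using S via_S_direct[of i j i' k] assms by (simp add: via_S_def)
  next
    assume "P (vx i j) (vx i' k) = seg i j (len i) \<frown> seg i' (len i') k"
    then show ?thesis
      using T via_T_direct assms by blast
  next
    fix m assume "m < 3" "m \<noteq> i" "m \<noteq> i'"
      "P (vx i j) (vx i' k) = seg i j 0 \<frown> seg m 0 (len m) \<frown> seg i' (len i') k"
    then show ?thesis
      using ST via_ST_not_direct assms by blast
  next
    fix m assume "m < 3" "m \<noteq> i" "m \<noteq> i'"
      "P (vx i j) (vx i' k) = seg i j (len i) \<frown> seg m (len m) 0 \<frown> seg i' 0 k"
    then show ?thesis
      using TS via_TS_not_direct assms by blast
  qed
qed

text \<open>Different arms, even parallel edges, have different first edges.\<close>

lemma direct_arm_unique:
  assumes "direct m 0 (len m)" "direct m' 0 (len m')" "m < 3" "m' < 3"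
  shows "m = m'"
proof -
  have "seg m 0 (len m) = seg m' 0 (len m')"
    using assms by (simp add: direct_def)
  then have "hd (pedges (seg m 0 (len m))) = hd (pedges (seg m' 0 (len m')))"
    by simp
  then show ?thesis
    using assms by (simp add: hd_pedges_leg)
qed

end

section \<open>Potentials that induce a path system\<close>

locale theta_direct_arm = theta_path_system +
  fixes X :: nat
  assumes X: "X < 3" and direct_X: "direct X 0 (len X)"
begin

text \<open>The number \<open>h i j\<close> stands for the distance from \<open>vx i j\<close> to \<open>BranchT\<close> minus that to \<open>BranchS\<close>, both
along arm \<open>i\<close>; thus \<open>h i 0\<close> is the weight of the arm. The clauses say that edges have positive
weight, that \<open>h\<close> is such a difference, that \<open>X\<close> is lightest, that within an arm the direct segment
is the shorter way around the cycle through \<open>X\<close> exactly when it is chosen, and that normal vertices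
of different arms are joined through the nearer branch vertex. The relation \<open>lt\<close> is \<open>(<)\<close> for strict
metrizability and \<open>(\<le>)\<close> for metrizability.\<close>

definition realizes :: "(real \<Rightarrow> real \<Rightarrow> bool) \<Rightarrow> (nat \<Rightarrow> nat \<Rightarrow> real) \<Rightarrow> bool" where
  "realizes lt h \<longleftrightarrow>
     (\<forall>i<3. \<forall>j<len i. h i (Suc j) < h i j) \<and>
     (\<forall>i<3. h i (len i) = - h i 0) \<and>
     (\<forall>i<3. i \<noteq> X \<longrightarrow> lt (h X 0) (h i 0)) \<and>
     (\<forall>i<3. i \<noteq> X \<longrightarrow> (\<forall>k\<le>len i. \<forall>j<k.
        if direct i j k then lt (h i j - h i k) (h i 0 + h X 0)
        else lt (h i 0 + h X 0) (h i j - h i k))) \<and>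
     (\<forall>i<3. \<forall>i'<3. i \<noteq> i' \<longrightarrow> (\<forall>j\<in>{0<..<len i}. \<forall>k\<in>{0<..<len i'}.
        normal i j \<and> normal i' k \<longrightarrow>
        (if via_S i j i' k then lt 0 (h i j + h i' k) else lt (h i j + h i' k) 0)))"

definition potential_weight :: "(nat \<Rightarrow> nat \<Rightarrow> real) \<Rightarrow> nat \<times> nat \<Rightarrow> real" where
  "potential_weight h = (\<lambda>(i, j). (h i j - h i (Suc j)) / 2)"

lemma arm_dist_potential_weight: "arm_dist (potential_weight h) i j = (h i 0 - h i j) / 2"
  by (induction j) (simp_all add: arm_dist_def potential_weight_def field_simps)

context
  fixes lt :: "real \<Rightarrow> real \<Rightarrow> bool" and h :: "nat \<Rightarrow> nat \<Rightarrow> real"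
  assumes lt: "lt = (<) \<or> lt = (\<le>)" and realizes: "realizes lt h"
begin

lemma lt_imp_le: "lt x y \<Longrightarrow> x \<le> y"
  using lt by auto

lemma less_imp_lt: "x < y \<Longrightarrow> lt x y"
  using lt by auto

text \<open>Reduces a comparison of weights to one clause of \<open>realizes\<close>, for \<open>(<)\<close> and \<open>(\<le>)\<close> alike. The factor
one half appears because the weights are half differences of potentials.\<close>

lemma lt_transfer: "lt x y \<Longrightarrow> (y - x) / 2 \<le> y' - x' \<Longrightarrow> lt x' y'"
  using lt by (elim disjE) (simp_all add: field_simps)

lemma h_less: "i < 3 \<Longrightarrow> j < k \<Longrightarrow> k \<le> len i \<Longrightarrow> h i k < h i j"
proof (induction k)
  case (Suc k)
  have "h i (Suc k) < h i k"
    using realizes Suc.prems by (simp add: realizes_def)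
  then show ?case
    using Suc by (cases "j = k") auto
qed simp

lemma h_len: "i < 3 \<Longrightarrow> h i (len i) = - h i 0"
  using realizes by (simp add: realizes_def)

lemma h_X_lt: "i < 3 \<Longrightarrow> i \<noteq> X \<Longrightarrow> lt (h X 0) (h i 0)"
  using realizes by (simp add: realizes_def)

lemma h_X_le: "i < 3 \<Longrightarrow> h X 0 \<le> h i 0"
  using lt_imp_le[OF h_X_lt] by (cases "i = X") auto

lemma h_X_pos: "0 < h X 0"
  using h_less[OF X len_pos[OF X]] h_len[OF X] by simp

lemma h_direct:
  assumes "i < 3" "i \<noteq> X" "j < k" "k \<le> len i"
  shows "direct i j k \<Longrightarrow> lt (h i j - h i k) (h i 0 + h X 0)"
    and "\<not> direct i j k \<Longrightarrow> lt (h i 0 + h X 0) (h i j - h i k)"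
  using realizes assms by (auto simp: realizes_def)

text \<open>The clause on vertices of one arm, applied to a vertex and a branch vertex. On the arm \<open>X\<close> itself
all vertices are normal and the bounds come from monotonicity.\<close>

lemma h_bounds:
  assumes "i < 3" "0 < j" "j < len i"
  shows "direct i j (len i) \<Longrightarrow> lt (h i j) (h X 0)"
    and "\<not> direct i j (len i) \<Longrightarrow> lt (h X 0) (h i j)"
    and "direct i 0 j \<Longrightarrow> lt (- h X 0) (h i j)"
    and "\<not> direct i 0 j \<Longrightarrow> lt (h i j) (- h X 0)"
proof -
  have X': "direct X j (len X)" "direct X 0 j" if "i = X"
    using direct_mono[OF direct_X X] assms that by simp_all
  have bd: "h i j < h i 0" "- h i 0 < h i j"
    using h_less[of i 0 j] h_less[of i j "len i"] h_len[of i] assms by simp_all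
  show "lt (h i j) (h X 0)" if "direct i j (len i)"
  proof (cases "i = X")
    case True
    then show ?thesis
      using bd less_imp_lt by simp
  next
    case False
    show ?thesis
      by (rule lt_transfer[OF h_direct(1)[OF assms(1) False assms(3) order_refl that]])
        (use lt_imp_le[OF h_direct(1)[OF assms(1) False assms(3) order_refl that]] h_len[OF assms(1)] in simp)
  qed
  show "lt (h X 0) (h i j)" if "\<not> direct i j (len i)"
  proof -
    have i: "i \<noteq> X"
      using X' that by auto
    show ?thesis
      by (rule lt_transfer[OF h_direct(2)[OF assms(1) i assms(3) order_refl that]])
        (use lt_imp_le[OF h_direct(2)[OF assms(1) i assms(3) order_refl that]] h_len[OF assms(1)] in simp)
  qed
  show "lt (- h X 0) (h i j)" if "direct i 0 j"
  proof (cases "i = X")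
    case True
    then show ?thesis
      using bd less_imp_lt by simp
  next
    case False
    note * = h_direct(1)[OF assms(1) False assms(2) less_imp_le[OF assms(3)] that]
    show ?thesis
      by (rule lt_transfer[OF *]) (use lt_imp_le[OF *] in simp)
  qed
  show "lt (h i j) (- h X 0)" if "\<not> direct i 0 j"
  proof -
    have i: "i \<noteq> X"
      using X' that by auto
    note * = h_direct(2)[OF assms(1) i assms(2) less_imp_le[OF assms(3)] that]
    show ?thesis
      by (rule lt_transfer[OF *]) (use lt_imp_le[OF *] in simp)
  qed
qed

abbreviation W :: "(theta_vertex, nat \<times> nat) path \<Rightarrow> real" where
  "W \<equiv> path_weight (potential_weight h)"

lemma same_arm_shortest:
  assumes "i < 3" "j < k" "k \<le> len i" and Q: "is_path G (vx i j) (vx i k) Q" "Q \<noteq> P (vx i j) (vx i k)"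
  shows "lt (W (P (vx i j) (vx i k))) (W Q)"
proof -
  have W_seg: "W (seg i j k) = (h i j - h i k) / 2"
    using assms by (simp add: path_weight_leg_up arm_dist_potential_weight field_simps)
  have W_detour: "W (seg i j 0 \<frown> seg m 0 (len m) \<frown> seg i (len i) k) = h i 0 + h m 0 - (h i j - h i k) / 2"
    if "m < 3" "m \<noteq> i" for m
    using assms that by (subst weight_via_ST) (simp_all add: arm_dist_potential_weight h_len field_simps)
  have dec: "h i k < h i j"
    using h_less assms by simp
  show ?thesis
  proof (cases "direct i j k")
    case True
    then obtain m where m: "m < 3" "m \<noteq> i" "Q = seg i j 0 \<frown> seg m 0 (len m) \<frown> seg i (len i) k"
      using same_arm_path[OF Q(1) assms(1-3)] Q(2) by (auto simp: direct_def)
    have "lt ((h i j - h i k) / 2) (h i 0 + h m 0 - (h i j - h i k) / 2)"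
    proof (cases "i = X")
      case True
      have "h i j \<le> h i 0"
        using h_less[OF assms(1), of 0 j] assms by (cases "j = 0") auto
      moreover have "h i (len i) \<le> h i k"
        using h_less[OF assms(1), of k "len i"] assms by (cases "k = len i") auto
      ultimately have "h i j - h i k \<le> 2 * h X 0"
        using h_len[OF assms(1)] True by simp
      then show ?thesis
        using lt_imp_le[OF h_X_lt[of m]] m True by (intro lt_transfer[OF h_X_lt[of m]]) (simp_all add: field_simps)
    next
      case False
      note * = h_direct(1)[OF assms(1) False assms(2,3) True]
      show ?thesis
        by (rule lt_transfer[OF *]) (use lt_imp_le[OF *] h_X_le[OF m(1)] in \<open>simp add: field_simps\<close>)
    qed
    then show ?thesis
      using True m by (simp add: direct_def W_seg W_detour)
  next
    case False
    obtain m where m: "m < 3" "m \<noteq> i" "direct m 0 (len m)"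
      and eq: "P (vx i j) (vx i k) = seg i j 0 \<frown> seg m 0 (len m) \<frown> seg i (len i) k"
      using detour[OF False assms(1-3)] by metis
    \<comment> \<open>The arm used by the detour is the lightest one, so detours along other arms are longer.\<close>
    have mX: "m = X"
      using direct_arm_unique m(1,3) X direct_X by blast
    note * = h_direct(2)[OF assms(1) _ assms(2,3) False]
    from same_arm_path[OF Q(1) assms(1-3)] show ?thesis
    proof (elim disjE exE conjE)
      assume "Q = seg i j k"
      moreover have "lt (h i 0 + h X 0 - (h i j - h i k) / 2) ((h i j - h i k) / 2)"
        by (rule lt_transfer[OF *]) (use m mX lt_imp_le[OF *] in \<open>auto simp: field_simps\<close>)
      ultimately show ?thesis
        using eq m mX by (simp add: W_seg W_detour)
    next
      fix m' assume m': "m' < 3" "m' \<noteq> i" "Q = seg i j 0 \<frown> seg m' 0 (len m') \<frown> seg i (len i) k"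
      then have "m' \<noteq> X"
        using Q(2) eq mX by auto
      then have "lt (h i 0 + h X 0 - (h i j - h i k) / 2) (h i 0 + h m' 0 - (h i j - h i k) / 2)"
        by (intro lt_transfer[OF h_X_lt[OF m'(1)]]) (use lt_imp_le[OF h_X_lt[OF m'(1)]] in simp_all)
      then show ?thesis
        using eq m mX m' by (simp add: W_detour)
    qed
  qed
qed

text \<open>The paths through \<open>BranchS\<close> and through \<open>BranchT\<close> differ in weight by the sum of the two
potentials. The path through \<open>BranchS\<close> is compared with one that runs along a third arm \<open>m\<close> by
comparing a potential with \<open>- h m 0\<close>, and similarly for \<open>BranchT\<close>. If one of the vertices is not
normal, the sign of the sum follows from the bounds on the potentials.\<close>

lemma cross_arm_shortest:
  assumes i: "i < 3" "i' < 3" "i \<noteq> i'" and jk: "0 < j" "j < len i" "0 < k" "k < len i'"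
    and Q: "is_path G (vx i j) (vx i' k) Q" "Q \<noteq> P (vx i j) (vx i' k)"
  shows "lt (W (P (vx i j) (vx i' k))) (W Q)"
proof -
  have W_S: "W (seg i j 0 \<frown> seg i' 0 k) = (h i 0 - h i j + (h i' 0 - h i' k)) / 2"
    using i by (simp add: weight_via_S arm_dist_potential_weight field_simps)
  have W_T: "W (seg i j (len i) \<frown> seg i' (len i') k) = (h i 0 + h i j + (h i' 0 + h i' k)) / 2"
    using i jk by (simp add: weight_via_T arm_dist_potential_weight h_len field_simps)
  have W_ST: "W (seg i j 0 \<frown> seg m 0 (len m) \<frown> seg i' (len i') k) =
      (h i 0 - h i j + (h i' 0 + h i' k)) / 2 + h m 0" if "m < 3" "m \<noteq> i" "m \<noteq> i'" for m
    using i jk that by (simp add: weight_via_ST arm_dist_potential_weight h_len field_simps)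
  have W_TS: "W (seg i j (len i) \<frown> seg m (len m) 0 \<frown> seg i' 0 k) =
      (h i 0 + h i j + (h i' 0 - h i' k)) / 2 + h m 0" if "m < 3" "m \<noteq> i" "m \<noteq> i'" for m
    using i jk that by (simp add: weight_via_TS arm_dist_potential_weight h_len field_simps)
  note W = W_S W_T W_ST W_TS
  note bounds = h_bounds[OF i(1) jk(1,2)] and bounds' = h_bounds[OF i(2) jk(3,4)]
  have third: "m' = m" if "m < 3" "m \<noteq> i" "m \<noteq> i'" "m' < 3" "m' \<noteq> i" "m' \<noteq> i'" for m m' :: nat
    using that i by linarith
  have cross: "if via_S i j i' k then lt 0 (h i j + h i' k) else lt (h i j + h i' k) 0"
    if "normal i j" "normal i' k"
    using realizes i jk that by (auto simp: realizes_def)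
  note Q_cases = cross_arm_path[OF Q(1) i jk]
  show ?thesis
    using i jk
  proof (cases rule: cross_arm_system_path)
    case S
    note b = bounds(3)[OF S(3)] and b' = bounds'(3)[OF S(4)]
    have "lt 0 (h i j + h i' k)"
    proof (cases "normal i j \<and> normal i' k")
      case True
      then show ?thesis
        using cross S(1) by simp
    next
      case False
      then consider "\<not> direct i j (len i)" | "\<not> direct i' k (len i')"
        using S by (auto simp: normal_def)
      then show ?thesis
      proof cases
        case 1
        show ?thesis
          by (rule lt_transfer[OF b']) (use lt_imp_le[OF b'] lt_imp_le[OF bounds(2)[OF 1]] in simp)
      next
        case 2
        show ?thesis
          by (rule lt_transfer[OF b]) (use lt_imp_le[OF b] lt_imp_le[OF bounds'(2)[OF 2]] in simp)
      qed
    qed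
    note sum = this
    from Q_cases Q(2) S(2) show ?thesis
    proof (elim disjE exE conjE)
      assume "Q = seg i j (len i) \<frown> seg i' (len i') k"
      then show ?thesis
        by (intro lt_transfer[OF sum]) (use lt_imp_le[OF sum] S(2) in \<open>simp add: W add_divide_distrib diff_divide_distrib\<close>)
    next
      fix m assume m: "m < 3" "m \<noteq> i" "m \<noteq> i'"
        and "Q = seg i j 0 \<frown> seg m 0 (len m) \<frown> seg i' (len i') k"
      then show ?thesis
        by (intro lt_transfer[OF b'])
          (use lt_imp_le[OF b'] S(2) h_X_le[OF m(1)] m in \<open>simp add: W add_divide_distrib diff_divide_distrib\<close>)
    next
      fix m assume m: "m < 3" "m \<noteq> i" "m \<noteq> i'"
        and "Q = seg i j (len i) \<frown> seg m (len m) 0 \<frown> seg i' 0 k"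
      then show ?thesis
        by (intro lt_transfer[OF b])
          (use lt_imp_le[OF b] S(2) h_X_le[OF m(1)] m in \<open>simp add: W add_divide_distrib diff_divide_distrib\<close>)
    qed simp
  next
    case T
    note b = bounds(1)[OF T(3)] and b' = bounds'(1)[OF T(4)]
    have "lt (h i j + h i' k) 0"
    proof (cases "normal i j \<and> normal i' k")
      case True
      then show ?thesis
        using cross T(1) by simp
    next
      case False
      then consider "\<not> direct i 0 j" | "\<not> direct i' 0 k"
        using T by (auto simp: normal_def)
      then show ?thesis
      proof cases
        case 1
        show ?thesis
          by (rule lt_transfer[OF b']) (use lt_imp_le[OF b'] lt_imp_le[OF bounds(4)[OF 1]] in simp)
      next
        case 2
        show ?thesis
          by (rule lt_transfer[OF b]) (use lt_imp_le[OF b] lt_imp_le[OF bounds'(4)[OF 2]] in simp)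
      qed
    qed
    note sum = this
    from Q_cases Q(2) T(2) show ?thesis
    proof (elim disjE exE conjE)
      assume "Q = seg i j 0 \<frown> seg i' 0 k"
      then show ?thesis
        by (intro lt_transfer[OF sum]) (use lt_imp_le[OF sum] T(2) in \<open>simp add: W add_divide_distrib diff_divide_distrib\<close>)
    next
      fix m assume m: "m < 3" "m \<noteq> i" "m \<noteq> i'"
        and "Q = seg i j 0 \<frown> seg m 0 (len m) \<frown> seg i' (len i') k"
      then show ?thesis
        by (intro lt_transfer[OF b])
          (use lt_imp_le[OF b] T(2) h_X_le[OF m(1)] m in \<open>simp add: W add_divide_distrib diff_divide_distrib\<close>)
    next
      fix m assume m: "m < 3" "m \<noteq> i" "m \<noteq> i'"
        and "Q = seg i j (len i) \<frown> seg m (len m) 0 \<frown> seg i' 0 k"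
      then show ?thesis
        by (intro lt_transfer[OF b'])
          (use lt_imp_le[OF b'] T(2) h_X_le[OF m(1)] m in \<open>simp add: W add_divide_distrib diff_divide_distrib\<close>)
    qed simp
  next
    case (ST m)
    have m: "m = X"
      using direct_arm_unique ST(1,4) X direct_X by blast
    note b = bounds(2)[OF ST(6)] and b' = bounds'(4)[OF ST(7)]
    from Q_cases show ?thesis
    proof (elim disjE exE conjE)
      assume "Q = seg i j 0 \<frown> seg i' 0 k"
      then show ?thesis
        by (intro lt_transfer[OF b']) (use lt_imp_le[OF b'] ST(1-3,5) m in \<open>simp add: W add_divide_distrib diff_divide_distrib\<close>)
    next
      assume "Q = seg i j (len i) \<frown> seg i' (len i') k"
      then show ?thesis
        by (intro lt_transfer[OF b]) (use lt_imp_le[OF b] ST(1-3,5) m in \<open>simp add: W add_divide_distrib diff_divide_distrib\<close>)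
    next
      fix m' assume m': "m' < 3" "m' \<noteq> i" "m' \<noteq> i'"
        and "Q = seg i j 0 \<frown> seg m' 0 (len m') \<frown> seg i' (len i') k"
      then show ?thesis
        using Q(2) ST(5) third[OF ST(1-3) m'] by simp
    next
      fix m' assume m': "m' < 3" "m' \<noteq> i" "m' \<noteq> i'"
        and "Q = seg i j (len i) \<frown> seg m' (len m') 0 \<frown> seg i' 0 k"
      then show ?thesis
        using third[OF ST(1-3) m']
        by (intro lt_transfer[OF b])
          (use lt_imp_le[OF b] lt_imp_le[OF b'] h_X_pos ST(1-3,5) m in \<open>simp add: W add_divide_distrib diff_divide_distrib\<close>)
    qed
  next
    case (TS m)
    have m: "m = X"
      using direct_arm_unique TS(1,4) X direct_X by blast
    note b = bounds(4)[OF TS(6)] and b' = bounds'(2)[OF TS(7)]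
    from Q_cases show ?thesis
    proof (elim disjE exE conjE)
      assume "Q = seg i j 0 \<frown> seg i' 0 k"
      then show ?thesis
        by (intro lt_transfer[OF b]) (use lt_imp_le[OF b] TS(1-3,5) m in \<open>simp add: W add_divide_distrib diff_divide_distrib\<close>)
    next
      assume "Q = seg i j (len i) \<frown> seg i' (len i') k"
      then show ?thesis
        by (intro lt_transfer[OF b']) (use lt_imp_le[OF b'] TS(1-3,5) m in \<open>simp add: W add_divide_distrib diff_divide_distrib\<close>)
    next
      fix m' assume m': "m' < 3" "m' \<noteq> i" "m' \<noteq> i'"
        and "Q = seg i j 0 \<frown> seg m' 0 (len m') \<frown> seg i' (len i') k"
      then show ?thesis
        using third[OF TS(1-3) m']
        by (intro lt_transfer[OF b])
          (use lt_imp_le[OF b] lt_imp_le[OF b'] h_X_pos TS(1-3,5) m in \<open>simp add: W add_divide_distrib diff_divide_distrib\<close>)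
    next
      fix m' assume m': "m' < 3" "m' \<noteq> i" "m' \<noteq> i'"
        and "Q = seg i j (len i) \<frown> seg m' (len m') 0 \<frown> seg i' 0 k"
      then show ?thesis
        using Q(2) TS(5) third[OF TS(1-3) m'] by simp
    qed
  qed
qed

lemma system_path_shortest:
  assumes "u \<in> verts G" "v \<in> verts G" "u \<noteq> v" and Q: "is_path G u v Q" "Q \<noteq> P u v"
  shows "lt (W (P u v)) (W Q)"
proof -
  obtain i j where u: "u = vx i j" "i < 3" "j \<le> len i"
    using assms(1) by (auto simp: verts_G)
  obtain i' k where v: "v = vx i' k" "i' < 3" "k \<le> len i'"
    using assms(2) by (auto simp: verts_G)
  have same: ?thesis if uv: "u = vx n p" "v = vx n q" "n < 3" "p \<le> len n" "q \<le> len n" for n p q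
  proof -
    consider "p < q" | "q < p"
      using assms(3) uv by fastforce
    then show ?thesis
    proof cases
      case 1
      then show ?thesis
        using same_arm_shortest[of n p q Q] Q uv by simp
    next
      case 2
      have rev: "P v u = rev_path (P u v)"
        using P_rev[OF assms(1-3)] .
      then have "is_path G v u (rev_path Q)" "rev_path Q \<noteq> P v u"
        using Q is_path_rev[OF Q(1)] rev_path_inject[of Q "P u v"] by simp_all
      then have "lt (W (P v u)) (W (rev_path Q))"
        using same_arm_shortest[of n q p "rev_path Q"] 2 uv by simp
      then show ?thesis
        by (simp add: rev)
    qed
  qed
  consider "i = i'" | "j = 0" | "j = len i" | "k = 0" | "k = len i'"
    | "i \<noteq> i'" "0 < j" "j < len i" "0 < k" "k < len i'"
    using u(3) v(3) by linarith
  then show ?thesis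
  proof cases
    case 6
    then show ?thesis
      using cross_arm_shortest[of i i' j k Q] u v Q by simp
  qed (use same[of i' 0 k] same[of i' "len i'" k] same[of i j 0] same[of i j "len i"] same[of i j k] u v in auto)
qed

lemma potential_weight_pos: "e \<in> edges G \<Longrightarrow> 0 < potential_weight h e"
  using h_less by (cases e) (auto simp: edges_G potential_weight_def)

end

lemma realizes_less_imp_strictly_metrizable_system:
  assumes "realizes (<) h"
  shows "strictly_metrizable_system G P"
  unfolding strictly_metrizable_system_def strictly_induces_def
  using potential_weight_pos[OF disjI1[OF refl] assms] system_path_shortest[OF disjI1[OF refl] assms]
  by blast

lemma realizes_le_imp_metrizable_system:
  assumes "realizes (\<le>) h"
  shows "metrizable_system G P"
  unfolding metrizable_system_def induces_def
  using potential_weight_pos[OF disjI2[OF refl] assms] system_path_shortest[OF disjI2[OF refl] assms]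
  by (metis order_refl)

end

section \<open>Sequences with prescribed signs of sums\<close>

text \<open>The set of all \<open>p\<close> with \<open>R p j\<close> is an initial segment that shrinks as \<open>j\<close> grows. Counting it yields
a weakly decreasing sequence that compares correctly with the integers \<open>p\<close>; a decreasing fraction
makes it strictly decreasing and different from all integers.\<close>

lemma ferrers_realization:
  fixes R :: "nat \<Rightarrow> nat \<Rightarrow> bool"
  assumes mono: "\<And>p j p' j'. \<lbrakk>R p j; 0 < p'; p' \<le> p; p < M; 0 < j'; j' \<le> j; j < N\<rbrakk> \<Longrightarrow> R p' j'"
  obtains r :: "nat \<Rightarrow> real" where
    "\<And>j j'. \<lbrakk>0 < j; j < j'; j' < N\<rbrakk> \<Longrightarrow> r j' < r j"
    "\<And>p j. \<lbrakk>0 < p; p < M; 0 < j; j < N; R p j\<rbrakk> \<Longrightarrow> real p < r j"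
    "\<And>p j. \<lbrakk>0 < p; p < M; 0 < j; j < N; \<not> R p j\<rbrakk> \<Longrightarrow> r j < real p"
proof -
  define n where "n j = card {p \<in> {0<..<M}. R p j}" for j
  define r where "r j = real (n j) + 1 / (real j + 2)" for j
  show ?thesis
  proof (rule that[of r])
    fix j j' :: nat assume j: "0 < j" "j < j'" "j' < N"
    have "n j' \<le> n j"
      unfolding n_def using mono j by (intro card_mono) force+
    moreover have "1 / (real j' + 2) < 1 / (real j + 2)"
      using j by (simp add: frac_less2)
    ultimately show "r j' < r j"
      by (simp add: r_def)
  next
    fix p j assume pj: "0 < p" "p < M" "0 < j" "j < N" "R p j"
    have "{0<..p} \<subseteq> {p \<in> {0<..<M}. R p j}"
      using mono[OF pj(5)] pj by auto
    from card_mono[OF _ this] have "p \<le> n j"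
      by (simp add: n_def)
    moreover have "0 < 1 / (real j + 2)"
      by simp
    ultimately show "real p < r j"
      unfolding r_def by linarith
  next
    fix p j assume pj: "0 < p" "p < M" "0 < j" "j < N" "\<not> R p j"
    have "{p \<in> {0<..<M}. R p j} \<subseteq> {0<..<p}"
    proof
      fix q assume q: "q \<in> {p \<in> {0<..<M}. R p j}"
      then have "\<not> p \<le> q"
        using mono[of q j p j] pj by auto
      then show "q \<in> {0<..<p}"
        using q by auto
    qed
    from card_mono[OF _ this] have "n j \<le> p - 1"
      by (simp add: n_def)
    then have "real (n j) \<le> real p - 1"
      using pj by linarith
    moreover have "1 / (real j + 2) < 1"
      by simp
    ultimately show "r j < real p"
      unfolding r_def by linarith
  qed
qed

lemma separating_real:
  fixes U V :: "real set"
  assumes "finite U" "finite V" "\<And>u v. u \<in> U \<Longrightarrow> v \<in> V \<Longrightarrow> u < v"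
  obtains A where "\<And>u. u \<in> U \<Longrightarrow> u < A" "\<And>v. v \<in> V \<Longrightarrow> A < v"
proof -
  consider "U = {}" "V = {}" | "U = {}" "V \<noteq> {}" | "U \<noteq> {}" "V = {}" | "U \<noteq> {}" "V \<noteq> {}"
    by blast
  then show ?thesis
  proof cases
    case 2
    then have "Min V - 1 < v" if "v \<in> V" for v
      using Min_le[OF assms(2) that] by simp
    then show ?thesis
      using that 2 by blast
  next
    case 3
    then have "u < Max U + 1" if "u \<in> U" for u
      using Max_ge[OF assms(1) that] by simp
    then show ?thesis
      using that 3 by blast
  next
    case 4
    then have "Max U < Min V"
      using assms by simp
    then obtain A where "Max U < A" "A < Min V"
      using dense by blast
    then show ?thesis
      using that[of A] 4 assms by simp
  qed (use that in blast)
qed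

lemma cut_decreasing:
  fixes f :: "nat \<Rightarrow> real" and D :: "nat \<Rightarrow> bool"
  assumes "\<And>j k. \<lbrakk>0 < j; j < k; k < N\<rbrakk> \<Longrightarrow> f k < f j"
    and "\<And>j k. \<lbrakk>D k; 0 < j; j < k; k < N\<rbrakk> \<Longrightarrow> D j"
  obtains A where "\<And>j. \<lbrakk>0 < j; j < N; D j\<rbrakk> \<Longrightarrow> A < f j" "\<And>j. \<lbrakk>0 < j; j < N; \<not> D j\<rbrakk> \<Longrightarrow> f j < A"
proof -
  have lt: "u < v" if uv: "u \<in> f ` {j \<in> {0<..<N}. \<not> D j}" "v \<in> f ` {j \<in> {0<..<N}. D j}" for u v
  proof -
    obtain j k where jk: "u = f j" "v = f k" "0 < j" "j < N" "\<not> D j" "0 < k" "k < N" "D k"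
      using uv by auto
    then have "k < j"
      using assms(2)[of k j] by (metis nat_neq_iff)
    then show ?thesis
      using assms(1) jk by simp
  qed
  obtain A where "\<And>u. u \<in> f ` {j \<in> {0<..<N}. \<not> D j} \<Longrightarrow> u < A" "\<And>v. v \<in> f ` {j \<in> {0<..<N}. D j} \<Longrightarrow> A < v"
    by (rule separating_real[OF _ _ lt]) auto
  then show ?thesis
    using that[of A] by (simp add: image_iff) blast
qed

lemma bounded_initial_segment:
  fixes f :: "nat \<Rightarrow> real"
  obtains K where "\<And>j. j < N \<Longrightarrow> \<bar>f j\<bar> < K"
proof
  fix j assume "j < N"
  then have "\<bar>f j\<bar> \<le> (\<Sum>j<N. \<bar>f j\<bar>)"
    by (intro member_le_sum) auto
  then show "\<bar>f j\<bar> < (\<Sum>j<N. \<bar>f j\<bar>) + 1"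
    by simp
qed

lemma other_arms:
  fixes m :: nat
  assumes "m < 3"
  obtains i i' where "i < 3" "i' < 3" "i \<noteq> i'" "i \<noteq> m" "i' \<noteq> m" "\<And>n. n < 3 \<Longrightarrow> n = m \<or> n = i \<or> n = i'"
proof -
  consider "m = 0" | "m = 1" | "m = 2"
    using assms by linarith
  then show ?thesis
  proof cases
    case 1
    show ?thesis
      by (rule that[of 1 2]) (use 1 in auto)
  next
    case 2
    show ?thesis
      by (rule that[of 0 2]) (use 2 in auto)
  next
    case 3
    show ?thesis
      by (rule that[of 0 1]) (use 3 in auto)
  qed
qed

context theta_direct_arm
begin

definition sign_compatible :: "(nat \<Rightarrow> nat \<Rightarrow> real) \<Rightarrow> nat \<Rightarrow> nat \<Rightarrow> bool" where
  "sign_compatible g i i' \<longleftrightarrow> (\<forall>j\<in>{0<..<len i}. \<forall>k\<in>{0<..<len i'}. normal i j \<and> normal i' k \<longrightarrow>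
     (if via_S i j i' k then 0 < g i j + g i' k else g i j + g i' k < 0))"

text \<open>The conditions of \<open>realizes\<close> that involve normal vertices only. Their bound by \<open>h X 0\<close> is left out,
because \<open>h X 0\<close> can be chosen as large as necessary.\<close>

definition core_potential :: "(nat \<Rightarrow> nat \<Rightarrow> real) \<Rightarrow> bool" where
  "core_potential g \<longleftrightarrow>
     (\<forall>i<3. \<forall>j k. 0 < j \<and> j < k \<and> k < len i \<and> normal i j \<and> normal i k \<longrightarrow> g i k < g i j) \<and>
     (\<forall>i<3. \<forall>i'<3. i \<noteq> i' \<longrightarrow> sign_compatible g i i')"

lemma sign_compatible_commute:
  assumes "i < 3" "i' < 3" "i \<noteq> i'" "sign_compatible g i i'"
  shows "sign_compatible g i' i"
  using assms via_S_commute[of i i'] by (auto simp: sign_compatible_def add.commute)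

lemma core_potentialI:
  assumes arms: "m < 3" "i < 3" "i' < 3" "i \<noteq> i'" "i \<noteq> m" "i' \<noteq> m" "\<And>n. n < 3 \<Longrightarrow> n = m \<or> n = i \<or> n = i'"
    and "\<And>n j k. \<lbrakk>n \<in> {m, i, i'}; 0 < j; j < k; k < len n; normal n j; normal n k\<rbrakk> \<Longrightarrow> g n k < g n j"
    and "sign_compatible g m i" "sign_compatible g m i'" "sign_compatible g i i'"
  shows "core_potential g"
proof -
  have "sign_compatible g i m" "sign_compatible g i' m" "sign_compatible g i' i"
    using sign_compatible_commute[OF arms(1,2) arms(5)[symmetric] assms(9)]
      sign_compatible_commute[OF arms(1,3) arms(6)[symmetric] assms(10)]
      sign_compatible_commute[OF arms(2-4) assms(11)] by simp_all
  then have "sign_compatible g n n'" if "n < 3" "n' < 3" "n \<noteq> n'" for n n'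
    using arms(7)[OF that(1)] arms(7)[OF that(2)] that(3) assms(9-11) by auto
  moreover have "n \<in> {m, i, i'}" if "n < 3" for n
    using arms(7)[OF that] by simp
  ultimately show ?thesis
    unfolding core_potential_def using assms(8) by simp
qed

text \<open>For the other two arms take the sequences \<open>r j\<close> and \<open>- j\<close> of a Ferrers realization. The one normal
vertex \<open>q\<close> of arm \<open>m\<close> must have a potential whose negative cuts the first sequence at a level \<open>A\<close> and
the second at a level \<open>B\<close>. Translating the sequences by \<open>- c\<close> and \<open>c\<close> does not change the sums of
their terms, and moves the two levels to \<open>A - c\<close> and \<open>B + c\<close>, which agree for \<open>c = (A - B) / 2\<close>.\<close>

lemma core_potential_if_normal_unique:
  assumes m: "m < 3" and unique: "\<And>j k. \<lbrakk>0 < j; j < k; k < len m; normal m j\<rbrakk> \<Longrightarrow> \<not> normal m k"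
  shows "\<exists>g. core_potential g"
proof -
  obtain i i' where arms: "i < 3" "i' < 3" "i \<noteq> i'" "i \<noteq> m" "i' \<noteq> m"
    "\<And>n. n < 3 \<Longrightarrow> n = m \<or> n = i \<or> n = i'"
    using other_arms[OF m] by blast
  have mono: "via_S i' p' i j'"
    if "via_S i' p i j" "0 < p'" "p' \<le> p" "p < len i'" "0 < j'" "j' \<le> j" "j < len i" for p j p' j'
    using via_S_mono[of i' p i j p' j'] that arms by simp
  obtain r where r: "\<And>j j'. \<lbrakk>0 < j; j < j'; j' < len i\<rbrakk> \<Longrightarrow> r j' < r j"
    "\<And>p j. \<lbrakk>0 < p; p < len i'; 0 < j; j < len i; via_S i' p i j\<rbrakk> \<Longrightarrow> real p < r j"
    "\<And>p j. \<lbrakk>0 < p; p < len i'; 0 < j; j < len i; \<not> via_S i' p i j\<rbrakk> \<Longrightarrow> r j < real p"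
    by (rule ferrers_realization[of "\<lambda>p j. via_S i' p i j" "len i'" "len i"], rule mono, assumption+, blast)
  obtain q where q: "\<And>j. \<lbrakk>0 < j; j < len m; normal m j\<rbrakk> \<Longrightarrow> j = q"
    using unique by (metis nat_neq_iff)
  \<comment> \<open>If arm \<open>m\<close> has no normal vertex, \<open>q\<close> is arbitrary; the bounds keep \<open>D n\<close> an initial segment.\<close>
  define D where "D n j \<longleftrightarrow> 0 < q \<and> q < len m \<and> via_S m q n j" for n j
  have D_mono: "D n j" if "D n k" "n < 3" "n \<noteq> m" "0 < j" "j < k" "k < len n" for n j k
    using via_S_mono[of m q n k q j] m that unfolding D_def by simp
  obtain A where A: "\<And>j. \<lbrakk>0 < j; j < len i; D i j\<rbrakk> \<Longrightarrow> A < r j" "\<And>j. \<lbrakk>0 < j; j < len i; \<not> D i j\<rbrakk> \<Longrightarrow> r j < A"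
    by (rule cut_decreasing[of "len i" r "D i"]) (use r(1) D_mono[of i] arms in auto)
  obtain B where B: "\<And>j. \<lbrakk>0 < j; j < len i'; D i' j\<rbrakk> \<Longrightarrow> B < - real j" "\<And>j. \<lbrakk>0 < j; j < len i'; \<not> D i' j\<rbrakk> \<Longrightarrow> - real j < B"
    by (rule cut_decreasing[of "len i'" "\<lambda>j. - real j" "D i'"]) (use D_mono[of i'] arms in auto)
  define c where "c = (A - B) / 2"
  define g where "g n j = (if n = i then r j - c else if n = i' then c - real j else - B - c)" for n j
  have g: "g i j = r j - c" "g i' j = c - real j" "g m j = - B - c" for j
    using arms by (auto simp: g_def)
  have "core_potential g"
  proof (rule core_potentialI[OF m arms])
    fix n j k assume n: "n \<in> {m, i, i'}" "0 < j" "j < k" "k < len n" "normal n j" "normal n k"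
    then have "n = i \<or> n = i'"
      using unique by blast
    then show "g n k < g n j"
      using n r(1) by (auto simp: g)
  next
    show "sign_compatible g m i"
      unfolding sign_compatible_def
    proof (intro ballI impI)
      fix j k assume *: "j \<in> {0<..<len m}" "k \<in> {0<..<len i}" "normal m j \<and> normal i k"
      then have "j = q"
        using q by simp
      then have "via_S m j i k \<longleftrightarrow> D i k"
        using * by (auto simp: D_def)
      then show "if via_S m j i k then 0 < g m j + g i k else g m j + g i k < 0"
        using A[of k] * by (auto simp: g c_def field_simps)
    qed
    show "sign_compatible g m i'"
      unfolding sign_compatible_def
    proof (intro ballI impI)
      fix j k assume *: "j \<in> {0<..<len m}" "k \<in> {0<..<len i'}" "normal m j \<and> normal i' k"
      then have "j = q"
        using q by simp
      then have "via_S m j i' k \<longleftrightarrow> D i' k"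
        using * by (auto simp: D_def)
      then show "if via_S m j i' k then 0 < g m j + g i' k else g m j + g i' k < 0"
        using B[of k] * by (auto simp: g field_simps)
    qed
    show "sign_compatible g i i'"
      unfolding sign_compatible_def
    proof (intro ballI impI)
      fix j k assume *: "j \<in> {0<..<len i}" "k \<in> {0<..<len i'}" "normal i j \<and> normal i' k"
      then have "via_S i j i' k \<longleftrightarrow> via_S i' k i j"
        using via_S_commute arms by simp
      then show "if via_S i j i' k then 0 < g i j + g i' k else g i j + g i' k < 0"
        using r(2,3)[of k j] * by (auto simp: g)
    qed
  qed
  then show ?thesis
    by blast
qed

text \<open>If all pairs from two arms are joined through the same branch vertex, the signs of their sums are
achieved by a large translation. So it suffices to realize the two relations with the third arm,
both against the same sequence, and then to translate that arm in the opposite direction.\<close>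

lemma core_potential_if_pair_one_sided:
  assumes i: "i < 3" "i' < 3" "i \<noteq> i'"
    and one_sided: "\<And>j k. \<lbrakk>0 < j; j < len i; 0 < k; k < len i'; normal i j; normal i' k\<rbrakk> \<Longrightarrow> via_S i j i' k = side"
  shows "\<exists>g. core_potential g"
proof -
  obtain m where arms: "m < 3" "i < 3" "i' < 3" "i \<noteq> i'" "i \<noteq> m" "i' \<noteq> m"
    "\<And>n. n < 3 \<Longrightarrow> n = m \<or> n = i \<or> n = i'"
  proof -
    obtain p q where pq: "p < 3" "q < 3" "p \<noteq> q" "p \<noteq> i" "q \<noteq> i" "\<And>n. n < 3 \<Longrightarrow> n = i \<or> n = p \<or> n = q"
      using other_arms[OF i(1)] by blast
    from pq(6)[OF i(2)] i(3) consider "i' = p" | "i' = q"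
      by auto
    then show ?thesis
    proof cases
      case 1
      show ?thesis
        by (rule that[of q]) (use 1 pq i in auto)
    next
      case 2
      show ?thesis
        by (rule that[of p]) (use 2 pq i in auto)
    qed
  qed
  have ex: "\<exists>r :: nat \<Rightarrow> real. (\<forall>j k. 0 < j \<and> j < k \<and> k < len n \<longrightarrow> r k < r j) \<and>
      (\<forall>p j. 0 < p \<and> p < len m \<and> 0 < j \<and> j < len n \<longrightarrow>
        (if via_S m p n j then real p < r j else r j < real p))"
    if "n < 3" "n \<noteq> m" for n
  proof -
    have mono: "via_S m p' n j'"
      if "via_S m p n j" "0 < p'" "p' \<le> p" "p < len m" "0 < j'" "j' \<le> j" "j < len n" for p j p' j'
      using via_S_mono[of m p n j p' j'] that \<open>n < 3\<close> \<open>n \<noteq> m\<close> arms(1) by simp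
    obtain r where "\<And>j j'. \<lbrakk>0 < j; j < j'; j' < len n\<rbrakk> \<Longrightarrow> r j' < r j"
      "\<And>p j. \<lbrakk>0 < p; p < len m; 0 < j; j < len n; via_S m p n j\<rbrakk> \<Longrightarrow> real p < r j"
      "\<And>p j. \<lbrakk>0 < p; p < len m; 0 < j; j < len n; \<not> via_S m p n j\<rbrakk> \<Longrightarrow> r j < real p"
      by (rule ferrers_realization[of "\<lambda>p j. via_S m p n j" "len m" "len n"], rule mono, assumption+, blast)
    then show ?thesis
      by (intro exI[of _ r]) auto
  qed
  obtain r where r: "\<And>j k. 0 < j \<and> j < k \<and> k < len i \<Longrightarrow> r k < r j"
    "\<And>p j. 0 < p \<and> p < len m \<and> 0 < j \<and> j < len i \<Longrightarrow> if via_S m p i j then real p < r j else r j < real p"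
    using ex[of i] arms by blast
  obtain r' where r': "\<And>j k. 0 < j \<and> j < k \<and> k < len i' \<Longrightarrow> r' k < r' j"
    "\<And>p j. 0 < p \<and> p < len m \<and> 0 < j \<and> j < len i' \<Longrightarrow> if via_S m p i' j then real p < r' j else r' j < real p"
    using ex[of i'] arms by blast
  obtain K where K: "\<And>j. j < len i \<Longrightarrow> \<bar>r j\<bar> < K"
    using bounded_initial_segment[of "len i" r] by blast
  obtain K' where K': "\<And>j. j < len i' \<Longrightarrow> \<bar>r' j\<bar> < K'"
    using bounded_initial_segment[of "len i'" r'] by blast
  \<comment> \<open>Large enough to outweigh any sum \<open>r j + r' k\<close>.\<close>
  define C where "C = (if side then (K + K') / 2 else - (K + K') / 2)"
  define g where "g n j = (if n = i then r j + C else if n = i' then r' j + C else - real j - C)" for n j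
  have g: "g i j = r j + C" "g i' j = r' j + C" "g m j = - real j - C" for j
    using arms by (auto simp: g_def)
  have "core_potential g"
  proof (rule core_potentialI[OF arms])
    fix n j k assume "n \<in> {m, i, i'}" "0 < j" "j < k" "k < len n"
    then show "g n k < g n j"
      using r(1) r'(1) by (auto simp: g)
  next
    show "sign_compatible g m i"
      using r(2) by (auto simp: sign_compatible_def g split: if_splits)
    show "sign_compatible g m i'"
      using r'(2) by (auto simp: sign_compatible_def g split: if_splits)
    show "sign_compatible g i i'"
      unfolding sign_compatible_def
    proof (intro ballI impI)
      fix j k assume *: "j \<in> {0<..<len i}" "k \<in> {0<..<len i'}" "normal i j \<and> normal i' k"
      then have "via_S i j i' k = side"
        using one_sided by simp
      then show "if via_S i j i' k then 0 < g i j + g i' k else g i j + g i' k < 0"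
        using K[of j] K'[of k] * by (cases side) (auto simp: g C_def field_simps abs_less_iff)
    qed
  qed
  then show ?thesis
    by blast
qed

end

section \<open>From core potentials to weights\<close>

context theta_direct_arm
begin

text \<open>The number of vertices behind \<open>vx i j\<close> that are reached from it by a detour. They are the last ones
of the arm.\<close>

definition detour_count :: "nat \<Rightarrow> nat \<Rightarrow> nat" where
  "detour_count i j = card {k \<in> {j<..len i}. \<not> direct i j k}"

text \<open>The amount by which the potential of a vertex with a detour to \<open>BranchT\<close> exceeds \<open>h X 0\<close>. As in the
Ferrers realization, it is an integer plus a decreasing fraction, here to be compared with the
integers \<open>len i - k\<close>.\<close>

definition excess :: "nat \<Rightarrow> nat \<Rightarrow> real" where
  "excess i j = real (detour_count i j) - 1 + 1 / (real j + 2)"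

text \<open>On an arm \<open>i \<noteq> X\<close> the vertices near \<open>BranchS\<close> get potentials above \<open>\<alpha>\<close>, those near \<open>BranchT\<close> get
potentials below \<open>- \<alpha>\<close>. In particular \<open>h i 0 = \<alpha> + excess i 0\<close>, so that a vertex \<open>j\<close> of the former
kind and a vertex \<open>k\<close> of the latter have a difference above \<open>h i 0 + \<alpha>\<close> exactly if
\<open>excess i j > len i - k\<close>.\<close>

definition extend_potential :: "(nat \<Rightarrow> nat \<Rightarrow> real) \<Rightarrow> real \<Rightarrow> nat \<Rightarrow> nat \<Rightarrow> real" where
  "extend_potential g \<alpha> i j =
     (if i = X then (if j = 0 then \<alpha> else if j = len i then - \<alpha> else g i j)
      else if j < len i \<and> \<not> direct i j (len i) then \<alpha> + excess i j
      else if 0 < j \<and> \<not> direct i 0 j then - \<alpha> - (excess i 0 - (real (len i) - real j))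
      else g i j)"

lemma detour_count_ge:
  assumes "i < 3" "j < k" "k \<le> len i" "\<not> direct i j k"
  shows "len i - k + 1 \<le> detour_count i j"
proof -
  have "{k..len i} \<subseteq> {k \<in> {j<..len i}. \<not> direct i j k}"
    using direct_mono[of i j _ j k] assms by auto
  from card_mono[OF _ this] show ?thesis
    using assms by (simp add: detour_count_def)
qed

lemma detour_count_le:
  assumes "i < 3" "j < k" "k \<le> len i" "direct i j k"
  shows "detour_count i j \<le> len i - k"
proof -
  have "{k \<in> {j<..len i}. \<not> direct i j k} \<subseteq> {k<..len i}"
    using direct_mono[of i j k j] assms by (auto simp: not_le[symmetric])
  from card_mono[OF _ this] show ?thesis
    by (simp add: detour_count_def)
qed

lemma detour_count_antimono:
  assumes "i < 3" "j \<le> j'"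
  shows "detour_count i j' \<le> detour_count i j"
  unfolding detour_count_def using direct_mono[of i j _ j'] assms
  by (intro card_mono) auto

lemma excess_gt:
  assumes "i < 3" "j < k" "k \<le> len i" "\<not> direct i j k"
  shows "real (len i) - real k < excess i j"
proof -
  have "real (len i) - real k + 1 \<le> real (detour_count i j)"
    using detour_count_ge[OF assms] assms by linarith
  moreover have "0 < 1 / (real j + 2)"
    by simp
  ultimately show ?thesis
    unfolding excess_def by linarith
qed

lemma excess_less:
  assumes "i < 3" "j < k" "k \<le> len i" "direct i j k"
  shows "excess i j < real (len i) - real k"
proof -
  have "real (detour_count i j) \<le> real (len i) - real k"
    using detour_count_le[OF assms] assms by linarith
  moreover have "1 / (real j + 2) < 1"
    by simp
  ultimately show ?thesis
    unfolding excess_def by linarith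
qed

lemma excess_strict_antimono:
  assumes "i < 3" "j < j'"
  shows "excess i j' < excess i j"
proof -
  have "real (detour_count i j') \<le> real (detour_count i j)"
    using detour_count_antimono[of i j j'] assms by simp
  moreover have "1 / (real j' + 2) < 1 / (real j + 2)"
    using assms by (simp add: frac_less2)
  ultimately show ?thesis
    unfolding excess_def by linarith
qed

lemma X_direct: "j < k \<Longrightarrow> k \<le> len X \<Longrightarrow> direct X j k"
  using direct_mono[OF direct_X X] by simp

lemma not_direct_arm: "i < 3 \<Longrightarrow> i \<noteq> X \<Longrightarrow> \<not> direct i 0 (len i)"
  using direct_arm_unique[of i X] X direct_X by blast

text \<open>A detour can only join a vertex above \<open>\<alpha>\<close> to one below \<open>- \<alpha>\<close>. Hence the conditions within an arm do
not restrict the potentials of normal vertices any further.\<close>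

lemma realizes_extend_potential:
  assumes g: "core_potential g" and \<alpha>: "0 < \<alpha>" "\<And>i j. \<lbrakk>i < 3; j < len i\<rbrakk> \<Longrightarrow> \<bar>g i j\<bar> < \<alpha>"
  shows "realizes (<) (extend_potential g \<alpha>)"
proof -
  define h where "h = extend_potential g \<alpha>"
  have h_0: "h i 0 = \<alpha> + excess i 0" and h_len: "h i (len i) = - \<alpha> - excess i 0" if "i < 3" "i \<noteq> X" for i
    using that not_direct_arm[OF that] by (simp_all add: h_def extend_potential_def)
  have h_X: "h X 0 = \<alpha>" "h X (len X) = - \<alpha>"
    using X len_pos[OF X] by (auto simp: h_def extend_potential_def simp del: len_pos)
  have h_s: "h i j = \<alpha> + excess i j" if "i \<noteq> X" "j < len i" "\<not> direct i j (len i)" for i j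
    using that by (simp add: h_def extend_potential_def)
  \<comment> \<open>A vertex cannot have detours to both branch vertices, so the potential is not that of a vertex with a detour to \<open>BranchT\<close>.\<close>
  have h_t: "h i k = - \<alpha> - (excess i 0 - (real (len i) - real k))"
    if "i < 3" "i \<noteq> X" "0 < k" "k \<le> len i" "\<not> direct i 0 k" for i k
  proof -
    have "direct i k (len i)" if "k < len i"
      using detour[of i 0 k] that \<open>i < 3\<close> \<open>0 < k\<close> \<open>k \<le> len i\<close> \<open>\<not> direct i 0 k\<close> by metis
    then show ?thesis
      using that by (auto simp: h_def extend_potential_def)
  qed
  have h_n: "h i j = g i j" if "i < 3" "0 < j" "j < len i" "normal i j" for i j
    using that by (auto simp: h_def extend_potential_def normal_def)
  have s_gt: "\<alpha> < h i j" if "i < 3" "i \<noteq> X" "j < len i" "\<not> direct i j (len i)" for i j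
    using h_s[of i j] excess_gt[of i j "len i"] that by simp
  have t_less: "h i k < - \<alpha>" if "i < 3" "i \<noteq> X" "0 < k" "k \<le> len i" "\<not> direct i 0 k" for i k
    using h_t[of i k] excess_gt[of i 0 k] that by simp
  have n_bound: "h i j < \<alpha>" "- \<alpha> < h i j" if "i < 3" "0 < j" "j < len i" "normal i j" for i j
    using h_n[OF that] \<alpha>(2)[of i j] that by auto
  have kinds: "normal i j \<or> \<not> direct i j (len i) \<or> \<not> direct i 0 j" for i j
    by (auto simp: normal_def)
  have lt_\<alpha>: "h i j < \<alpha>" if "i < 3" "i \<noteq> X" "0 < j" "j \<le> len i" "j < len i \<Longrightarrow> direct i j (len i)" for i j
  proof (cases "direct i 0 j")
    case True
    then have "j < len i"
      using not_direct_arm[of i] that by (cases "j = len i") auto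
    then show ?thesis
      using n_bound that True by (simp add: normal_def)
  next
    case False
    then show ?thesis
      using t_less[of i j] that \<alpha>(1) by simp
  qed
  have gt_\<alpha>: "- \<alpha> < h i j" if "i < 3" "i \<noteq> X" "j < len i" "0 < j \<Longrightarrow> direct i 0 j" for i j
  proof (cases "direct i j (len i)")
    case True
    then have "0 < j"
      using not_direct_arm[of i] that by (cases "j = 0") auto
    then show ?thesis
      using n_bound that True by (simp add: normal_def)
  next
    case False
    then show ?thesis
      using s_gt[of i j] that \<alpha>(1) by simp
  qed
  have dec: "h i (Suc j) < h i j" if i: "i < 3" and j: "j < len i" for i j
  proof (cases "i = X")
    case True
    have "normal X j" if "0 < j" "j < len X" for j
      using X_direct that by (simp add: normal_def)
    then have "g X (Suc j) < g X j" if "0 < j" "Suc j < len X"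
      using g X that unfolding core_potential_def by (metis Suc_lessD lessI zero_less_Suc)
    then show ?thesis
      using \<alpha>(1) \<alpha>(2)[OF i, of j] \<alpha>(2)[OF i, of "Suc j"] j True
      by (auto simp: h_def extend_potential_def abs_less_iff split: if_splits)
  next
    case False
    show ?thesis
    proof (cases "direct i j (len i)")
      case s: False
      show ?thesis
      proof (cases "Suc j < len i \<and> \<not> direct i (Suc j) (len i)")
        case True
        then show ?thesis
          using h_s[OF False, of j] h_s[OF False, of "Suc j"] s j excess_strict_antimono[OF i, of j "Suc j"] by simp
      next
        case False
        then show ?thesis
          using lt_\<alpha>[of i "Suc j"] s_gt[of i j] s i j \<open>i \<noteq> X\<close> by auto
      qed
    next
      case True
      then have j0: "0 < j"
        using not_direct_arm[of i] i False by (cases "j = 0") auto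
      have j': "Suc j < len i \<Longrightarrow> direct i (Suc j) (len i)"
        using direct_mono[OF True i, of "Suc j" "len i"] by simp
      show ?thesis
      proof (cases "direct i 0 j")
        case t: False
        then have "\<not> direct i 0 (Suc j)"
          using direct_mono[of i 0 "Suc j" 0 j] i j j0 by auto
        then show ?thesis
          using h_t[of i j] h_t[of i "Suc j"] i j j0 False t by simp
      next
        case n: True
        show ?thesis
        proof (cases "direct i 0 (Suc j)")
          case t': True
          then have "Suc j < len i"
            using not_direct_arm[of i] i j False by (cases "Suc j = len i") auto
          moreover from this have "normal i j" "normal i (Suc j)"
            using True n t' j' by (simp_all add: normal_def)
          moreover from calculation have "g i (Suc j) < g i j"
            using g i j0 unfolding core_potential_def by blast
          ultimately show ?thesis
            using h_n i j j0 by simp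
        next
          case t': False
          then show ?thesis
            using t_less[of i "Suc j"] gt_\<alpha>[of i j] i j False n by simp
        qed
      qed
    qed
  qed
  have dec': "h i k < h i j" if "i < 3" "j < k" "k \<le> len i" for i j k
    using that(2,3)
  proof (induction k)
    case (Suc k)
    then show ?case
      using dec[OF that(1), of k] by (cases "j = k") auto
  qed simp
  have direct_iff: "if direct i j k then h i j - h i k < h i 0 + h X 0 else h i 0 + h X 0 < h i j - h i k"
    if i: "i < 3" "i \<noteq> X" and jk: "j < k" "k \<le> len i" for i j k
  proof -
    have s0: "h i j \<le> h i 0"
      using dec'[OF i(1), of 0 j] jk by (cases "j = 0") auto
    have t0: "- h i 0 \<le> h i k"
      using dec'[OF i(1), of k "len i"] h_0[OF i] h_len[OF i] jk by (cases "k = len i") auto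
    consider (s) "direct i j (len i)" | (t) "k < len i" "direct i 0 k"
      | (st) "\<not> direct i j (len i)" "\<not> direct i 0 k"
      | (tt) "\<not> direct i j (len i)" "k = len i" "direct i 0 k"
      using jk by linarith
    then show ?thesis
    proof cases
      case s
      then have "0 < j"
        using not_direct_arm[of i] i by (cases "j = 0") auto
      then have "h i j < \<alpha>"
        using lt_\<alpha>[of i j] s i jk by simp
      moreover have "direct i j k"
        using direct_mono[OF s i(1)] jk by simp
      ultimately show ?thesis
        using t0 h_X by simp
    next
      case t
      then have "- \<alpha> < h i k"
        using gt_\<alpha>[of i k] i by simp
      moreover have "direct i j k"
        using direct_mono[OF t(2) i(1)] jk by simp
      ultimately show ?thesis
        using s0 h_X by simp
    next
      case st
      have "h i j = \<alpha> + excess i j" "h i k = - \<alpha> - (excess i 0 - (real (len i) - real k))"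
        using h_s h_t st i jk by simp_all
      then show ?thesis
        using excess_gt[of i j k] excess_less[of i j k] h_0[OF i] h_X i jk by auto
    next
      case tt
      then show ?thesis
        using not_direct_arm[OF i] by simp
    qed
  qed
  have cross: "if via_S i j i' k then 0 < h i j + h i' k else h i j + h i' k < 0"
    if "i < 3" "i' < 3" "i \<noteq> i'" "0 < j" "j < len i" "0 < k" "k < len i'" "normal i j" "normal i' k" for i i' j k
    using g that h_n unfolding core_potential_def sign_compatible_def by simp
  have "h X 0 < h i 0" if "i < 3" "i \<noteq> X" for i
    using s_gt[OF that len_pos[OF that(1)]] not_direct_arm[OF that] h_X by simp
  moreover have "h i (len i) = - h i 0" if "i < 3" for i
    using h_0[OF that] h_len[OF that] h_X by (cases "i = X") auto
  ultimately show ?thesis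
    using dec direct_iff cross unfolding realizes_def h_def[symmetric] by simp
qed

lemma core_potential_imp_strictly_metrizable_system:
  assumes "core_potential g"
  shows "strictly_metrizable_system G P"
proof -
  have "\<exists>K. \<forall>j<len i. \<bar>g i j\<bar> < K" for i
    using bounded_initial_segment[of "len i" "g i"] by blast
  then obtain K where K: "\<And>i j. j < len i \<Longrightarrow> \<bar>g i j\<bar> < K i"
    by metis
  let ?\<alpha> = "\<bar>K 0\<bar> + \<bar>K 1\<bar> + \<bar>K 2\<bar> + 1"
  have "\<bar>g i j\<bar> < ?\<alpha>" if "i < 3" "j < len i" for i j
  proof -
    have "i = 0 \<or> i = 1 \<or> i = 2"
      using that(1) by linarith
    then show ?thesis
      using K[OF that(2)] by auto
  qed
  then have "realizes (<) (extend_potential g ?\<alpha>)"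
    by (intro realizes_extend_potential[OF assms]) simp_all
  then show ?thesis
    by (rule realizes_less_imp_strictly_metrizable_system)
qed

lemma strictly_metrizable_system_if_normal_unique:
  assumes "m < 3" "\<And>j k. \<lbrakk>0 < j; j < k; k < len m; normal m j\<rbrakk> \<Longrightarrow> \<not> normal m k"
  shows "strictly_metrizable_system G P"
proof -
  have "\<exists>g. core_potential g"
    by (rule core_potential_if_normal_unique[OF assms(1)]) (rule assms(2))
  then show ?thesis
    using core_potential_imp_strictly_metrizable_system by blast
qed

text \<open>Either one of the two criteria for a core potential applies, or all inner vertices are normal and
every pair of arms has the vertices next to \<open>BranchS\<close> joined through \<open>BranchS\<close> and those next to
\<open>BranchT\<close> joined through \<open>BranchT\<close>. In the latter case all edges can be given the same weight: then
the remaining pairs have equally long paths through both branch vertices.\<close>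

lemma metrizable_system_if_all_arms_3:
  assumes len: "\<And>i. i < 3 \<Longrightarrow> len i = 3"
  shows "metrizable_system G P"
proof -
  have pos: "j = 1 \<or> j = 2" if "0 < j" "j < 3" for j :: nat
    using that by linarith
  consider (abnormal) m where "m < 3" "\<not> (normal m 1 \<and> normal m 2)"
    | (all_T) i i' where "i < 3" "i' < 3" "i \<noteq> i'" "\<not> via_S i 1 i' 1"
    | (all_S) i i' where "i < 3" "i' < 3" "i \<noteq> i'" "via_S i 2 i' 2"
    | (tight) "\<And>i. i < 3 \<Longrightarrow> normal i 1" "\<And>i. i < 3 \<Longrightarrow> normal i 2"
      "\<And>i i'. \<lbrakk>i < 3; i' < 3; i \<noteq> i'\<rbrakk> \<Longrightarrow> via_S i 1 i' 1"
      "\<And>i i'. \<lbrakk>i < 3; i' < 3; i \<noteq> i'\<rbrakk> \<Longrightarrow> \<not> via_S i 2 i' 2"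
    by blast
  then show ?thesis
  proof cases
    case abnormal
    have "\<not> normal m k" if "0 < j" "j < k" "k < len m" "normal m j" for j k
    proof -
      have jk: "j = 1" "k = 2"
        using that len[OF abnormal(1)] by auto
      show ?thesis
        using abnormal(2) that(4) unfolding jk by blast
    qed
    then have "strictly_metrizable_system G P"
      by (rule strictly_metrizable_system_if_normal_unique[OF abnormal(1)])
    then show ?thesis
      by (rule strictly_metrizable_system_imp_metrizable_system)
  next
    case all_T
    have one_sided: "via_S i j i' k = False" if "0 < j" "j < len i" "0 < k" "k < len i'" for j k
      using via_S_mono[of i j i' k 1 1] all_T that by auto
    have "\<exists>g. core_potential g"
      by (rule core_potential_if_pair_one_sided[OF all_T(1-3)]) (rule one_sided)
    then show ?thesis
      using core_potential_imp_strictly_metrizable_system strictly_metrizable_system_imp_metrizable_system by blast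
  next
    case all_S
    have one_sided: "via_S i j i' k = True" if "0 < j" "j < len i" "0 < k" "k < len i'" for j k
      using via_S_mono[of i 2 i' 2 j k] all_S that len by simp
    have "\<exists>g. core_potential g"
      by (rule core_potential_if_pair_one_sided[OF all_S(1-3)]) (rule one_sided)
    then show ?thesis
      using core_potential_imp_strictly_metrizable_system strictly_metrizable_system_imp_metrizable_system by blast
  next
    case tight
    define h :: "nat \<Rightarrow> nat \<Rightarrow> real" where "h i j = 3 - 2 * real j" for i j
    have normal: "normal i j" if "i < 3" "0 < j" "j < 3" for i j
      using tight(1,2) pos[OF that(2,3)] that(1) by auto
    have "realizes (\<le>) h"
      unfolding realizes_def
    proof (intro conjI allI impI ballI)
      fix i j k assume i: "i < 3" "i \<noteq> X" and k: "k \<le> len i" "j < k"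
      have "direct i j k" if "0 < j \<or> k < 3"
        using that
      proof
        assume "0 < j"
        then have "direct i j (len i)"
          using normal[of i j] i k len by (simp add: normal_def)
        then show ?thesis
          using direct_mono[of i j "len i" j k] i k by simp
      next
        assume "k < 3"
        then have "direct i 0 k"
          using normal[of i k] i k by (simp add: normal_def)
        then show ?thesis
          using direct_mono[of i 0 k j k] i k by simp
      qed
      then have "j = 0 \<and> k = 3" if "\<not> direct i j k"
        using that k len[OF i(1)] by force
      then show "if direct i j k then h i j - h i k \<le> h i 0 + h X 0 else h i 0 + h X 0 \<le> h i j - h i k"
        using k len[OF i(1)] by (auto simp: h_def)
    next
      fix i i' j k assume i: "i < 3" "i' < 3" "i \<noteq> i'" and "j \<in> {0<..<len i}" "k \<in> {0<..<len i'}"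
      then have "j = 1 \<or> j = 2" "k = 1 \<or> k = 2"
        using pos len by auto
      then show "if via_S i j i' k then 0 \<le> h i j + h i' k else h i j + h i' k \<le> 0"
        using tight(3,4)[OF i] by (auto simp: h_def)
    qed (use len in \<open>auto simp: h_def\<close>)
    then show ?thesis
      by (rule realizes_le_imp_metrizable_system)
  qed
qed

end

context theta_arms
begin

lemma strictly_metrizable_if_short_arm:
  assumes "m < 3" "len m \<le> 2"
  shows "strictly_metrizable G"
  unfolding strictly_metrizable_def
proof (intro allI impI)
  fix P assume P: "path_system G P \<and> consistent G P"
  interpret theta_path_system a b c P
    using P by unfold_locales auto
  obtain X where "X < 3" "direct X 0 (len X)"
    using ex_direct_arm by blast
  then interpret theta_direct_arm a b c P X
    by unfold_locales
  show "strictly_metrizable_system G P"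
    by (rule strictly_metrizable_system_if_normal_unique[OF assms(1)]) (use assms(2) in simp)
qed

lemma metrizable_if_all_arms_3:
  assumes "\<And>i. i < 3 \<Longrightarrow> len i = 3"
  shows "metrizable G"
  unfolding metrizable_def
proof (intro allI impI)
  fix P assume P: "path_system G P \<and> consistent G P"
  interpret theta_path_system a b c P
    using P by unfold_locales auto
  obtain X where "X < 3" "direct X 0 (len X)"
    using ex_direct_arm by blast
  then interpret theta_direct_arm a b c P X
    by unfold_locales
  show "metrizable_system G P"
    by (rule metrizable_system_if_all_arms_3[OF assms])
qed

end

section \<open>A path system that prescribes a cyclic pattern\<close>

definition tl_path :: "('v, 'e) path \<Rightarrow> ('v, 'e) path" where
  "tl_path Q = Path (tl (pverts Q)) (tl (pedges Q))"

text \<open>Repeated removal of first edges yields all final parts of a path, hence by reversal all initial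
parts, and a subpath is a final part of an initial part.\<close>

lemma consistent_if_tl_paths:
  assumes system: "path_system G P"
    and tails: "\<And>u v. \<lbrakk>u \<in> verts G; v \<in> verts G; u \<noteq> v; 2 \<le> length (pedges (P u v))\<rbrakk> \<Longrightarrow>
      P (pverts (P u v) ! 1) v = tl_path (P u v)"
  shows "consistent G P"
proof -
  have path: "is_path G u v (P u v)" and rev: "P v u = rev_path (P u v)"
    if "u \<in> verts G" "v \<in> verts G" "u \<noteq> v" for u v
    using system that unfolding path_system_def by blast+
  have length_verts: "length (pverts (P u v)) = Suc (length (pedges (P u v)))"
    and in_verts: "\<And>i. i \<le> length (pedges (P u v)) \<Longrightarrow> pverts (P u v) ! i \<in> verts G"
    and last: "pverts (P u v) ! length (pedges (P u v)) = v"
    and first: "pverts (P u v) ! 0 = u"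
    and dist: "distinct (pverts (P u v))"
    if "u \<in> verts G" "v \<in> verts G" "u \<noteq> v" for u v
    using path[OF that] nth_mem[of _ "pverts (P u v)"]
    by (auto simp: is_path_def last_conv_nth hd_conv_nth simp flip: length_greater_0_conv)
  have suffix: "P (pverts (P u v) ! i) v = Path (drop i (pverts (P u v))) (drop i (pedges (P u v)))"
    if uv: "u \<in> verts G" "v \<in> verts G" "u \<noteq> v" and i: "i < length (pedges (P u v))" for u v i
    using i
  proof (induction i)
    case 0
    then show ?case
      using first[OF uv] by simp
  next
    case (Suc i)
    let ?x = "pverts (P u v) ! i"
    have IH: "P ?x v = Path (drop i (pverts (P u v))) (drop i (pedges (P u v)))"
      using Suc by simp
    have "?x \<noteq> v"
      using last[OF uv] dist[OF uv] length_verts[OF uv] Suc.prems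
      by (metis Suc_lessD less_SucI lessI nat_neq_iff nth_eq_iff_index_eq)
    moreover have "?x \<in> verts G"
      using in_verts[OF uv] Suc.prems by simp
    moreover have "2 \<le> length (pedges (P ?x v))"
      using Suc.prems by (simp add: IH)
    ultimately have "P (pverts (P ?x v) ! 1) v = tl_path (P ?x v)"
      using tails uv by blast
    then show ?case
      using Suc.prems length_verts[OF uv] by (simp add: IH tl_path_def drop_Suc tl_drop)
  qed
  have prefix: "P u (pverts (P u v) ! j) = Path (take (Suc j) (pverts (P u v))) (take j (pedges (P u v)))"
    if uv: "u \<in> verts G" "v \<in> verts G" "u \<noteq> v" and j: "0 < j" "j \<le> length (pedges (P u v))" for u v j
  proof -
    let ?n = "length (pedges (P u v))" and ?x = "pverts (P u v) ! j"
    have P_vu: "P v u = rev_path (P u v)"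
      using rev[OF uv] .
    have "P (pverts (P v u) ! (?n - j)) u = Path (drop (?n - j) (pverts (P v u))) (drop (?n - j) (pedges (P v u)))"
      by (rule suffix) (use uv j P_vu in \<open>auto simp: rev_path_def\<close>)
    moreover have "pverts (P v u) ! (?n - j) = ?x"
      using length_verts[OF uv] j by (simp add: P_vu rev_path_def rev_nth)
    ultimately have "P ?x u = Path (drop (?n - j) (rev (pverts (P u v)))) (drop (?n - j) (rev (pedges (P u v))))"
      by (simp add: P_vu rev_path_def)
    moreover have "?x \<noteq> u"
      using first[OF uv] dist[OF uv] length_verts[OF uv] j
      by (metis le_imp_less_Suc less_numeral_extra(3) nth_eq_iff_index_eq zero_less_Suc)
    then have "P u ?x = rev_path (P ?x u)"
      using rev[of ?x u] in_verts[OF uv j(2)] uv(1) by blast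
    ultimately show ?thesis
      using length_verts[OF uv] j by (simp add: rev_path_def rev_drop Suc_diff_le)
  qed
  show ?thesis
    unfolding consistent_def
  proof (intro ballI impI allI)
    fix u v i j assume uv: "u \<in> verts G" "v \<in> verts G" "u \<noteq> v" and ij: "i < j \<and> j < length (pverts (P u v))"
    let ?y = "pverts (P u v) ! j"
    have j: "0 < j" "j \<le> length (pedges (P u v))"
      using ij length_verts[OF uv] by auto
    note pre = prefix[OF uv j]
    have "?y \<noteq> u"
      using first[OF uv] dist[OF uv] length_verts[OF uv] j
      by (metis le_imp_less_Suc less_numeral_extra(3) nth_eq_iff_index_eq zero_less_Suc)
    then have "P (pverts (P u ?y) ! i) ?y = Path (drop i (pverts (P u ?y))) (drop i (pedges (P u ?y)))"
      using suffix[of u ?y i] uv(1) in_verts[OF uv j(2)] ij j by (simp add: pre)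
    then show "subpath (P u v) i j = P (pverts (P u v) ! i) (pverts (P u v) ! j)"
      using ij by (simp add: pre subpath_def drop_take Suc_diff_le)
  qed
qed

lemma tl_path_join: "pverts Q \<noteq> [] \<Longrightarrow> pedges Q \<noteq> [] \<Longrightarrow> tl_path (Q \<frown> R) = tl_path Q \<frown> R"
  by (simp add: tl_path_def join_def)

lemma tl_path_leg_up: "j < k \<Longrightarrow> tl_path (leg l i j k) = leg l i (Suc j) k"
  by (simp add: tl_path_def leg_up[of j k])

lemma tl_path_leg_down: "k < j \<Longrightarrow> tl_path (leg l i j k) = leg l i (j - 1) k"
  by (simp add: tl_path_def leg_down[of k j])

lemma leg_second:
  assumes "j \<noteq> k"
  shows "pverts (leg l i j k) ! 1 = arm_vertex l i (if j < k then Suc j else j - 1)"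
proof -
  have "pverts (leg l i j' k) ! 0 = arm_vertex l i j'" for j'
    using hd_conv_nth[of "pverts (leg l i j' k)"] by simp
  then show ?thesis
    using assms by (cases "j < k") (simp_all add: leg_up[of j k] leg_down[of k j])
qed

context theta_arms
begin

lemma is_path_seg_up:
  assumes "i < 3" "j \<le> k" "k \<le> len i"
  shows "is_path G (vx i j) (vx i k) (seg i j k)"
proof -
  have "inj_on (vx i) {j..<Suc k}"
    using assms by (auto simp: inj_on_def vx_eq_iff)
  then have "distinct (pverts (seg i j k))"
    using assms(2) by (simp add: leg_def distinct_map del: upt_Suc)
  moreover have "set (pverts (seg i j k)) \<subseteq> verts G"
    using assms by (auto simp: set_leg)
  moreover have "pedges (seg i j k) ! p \<in> edges G \<and>
      ends G (pedges (seg i j k) ! p) = {pverts (seg i j k) ! p, pverts (seg i j k) ! Suc p}"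
    if "p < length (pedges (seg i j k))" for p
    using that assms by (simp add: leg_def edges_G ends_G del: upt_Suc)
  moreover have "length (pverts (seg i j k)) = Suc (length (pedges (seg i j k)))"
    using wf_leg[of "len i" i j k] by (simp add: wf_path_def)
  ultimately show ?thesis
    by (simp add: is_path_def)
qed

lemma is_path_seg:
  assumes "i < 3" "j \<le> len i" "k \<le> len i"
  shows "is_path G (vx i j) (vx i k) (seg i j k)"
proof (cases "j \<le> k")
  case True
  then show ?thesis
    using is_path_seg_up assms by simp
next
  case False
  then show ?thesis
    using is_path_rev[OF is_path_seg_up[of i k j]] assms by simp
qed

lemma is_path_via_S:
  assumes "i < 3" "i' < 3" "i \<noteq> i'" "j < len i" "0 < k" "k \<le> len i'"
  shows "is_path G (vx i j) (vx i' k) (seg i j 0 \<frown> seg i' 0 k)"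
proof (rule is_path_join)
  show "is_path G (vx i j) BranchS (seg i j 0)"
    using is_path_seg[of i j 0] assms by simp
  show "is_path G BranchS (vx i' k) (seg i' 0 k)"
    using is_path_seg[of i' 0 k] assms by simp
  have "set (tl (pverts (seg i' 0 k))) = vx i' ` {1..k}"
    using assms by (simp add: leg_up[of 0 k] set_leg)
  then show "set (pverts (seg i j 0)) \<inter> set (tl (pverts (seg i' 0 k))) = {}"
    using assms by (auto simp: set_leg vx_eq_iff)
qed

lemma is_path_via_T:
  assumes "i < 3" "i' < 3" "i \<noteq> i'" "0 < j" "j \<le> len i" "k < len i'"
  shows "is_path G (vx i j) (vx i' k) (seg i j (len i) \<frown> seg i' (len i') k)"
proof (rule is_path_join)
  show "is_path G (vx i j) BranchT (seg i j (len i))"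
    using is_path_seg[of i j "len i"] assms by simp
  show "is_path G BranchT (vx i' k) (seg i' (len i') k)"
    using is_path_seg[of i' "len i'" k] assms by simp
  have "set (tl (pverts (seg i' (len i') k))) = vx i' ` {k..len i' - 1}"
    using assms by (simp add: leg_down[of k "len i'"] set_leg)
  then show "set (pverts (seg i j (len i))) \<inter> set (tl (pverts (seg i' (len i') k))) = {}"
    using assms by (auto simp: set_leg vx_eq_iff)
qed

text \<open>Of two arms, the one that precedes the other in the cyclic order decides: its vertex next to
\<open>BranchS\<close> goes through \<open>BranchS\<close>, all its other inner vertices go through \<open>BranchT\<close>.\<close>

definition cyclic_via_S :: "nat \<Rightarrow> nat \<Rightarrow> nat \<Rightarrow> nat \<Rightarrow> bool" where
  "cyclic_via_S i j i' k \<longleftrightarrow> (if i' = Suc i mod 3 then j = 1 else k = 1)"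

text \<open>All inner vertices are normal. Any arm could serve as the path between the branch vertices; it is
arm 0 here.\<close>

fun cyclic_system :: "theta_vertex \<Rightarrow> theta_vertex \<Rightarrow> (theta_vertex, nat \<times> nat) path" where
  "cyclic_system (Inner i j) (Inner i' k) =
     (if i = i' then seg i j k
      else if cyclic_via_S i j i' k then seg i j 0 \<frown> seg i' 0 k
      else seg i j (len i) \<frown> seg i' (len i') k)"
| "cyclic_system BranchS (Inner i k) = seg i 0 k"
| "cyclic_system BranchT (Inner i k) = seg i (len i) k"
| "cyclic_system (Inner i j) BranchS = seg i j 0"
| "cyclic_system (Inner i j) BranchT = seg i j (len i)"
| "cyclic_system BranchS v = seg 0 0 (len 0)"
| "cyclic_system BranchT v = seg 0 (len 0) 0"

lemma cyclic_system_seg: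
  assumes "i < 3" "j \<le> len i" "k \<le> len i" "j \<noteq> k" "0 < j \<and> j < len i \<or> 0 < k \<and> k < len i"
  shows "cyclic_system (vx i j) (vx i k) = seg i j k"
  using assms by (auto simp: arm_vertex_def)

lemma cyclic_system_cases:
  assumes "u \<in> verts G" "v \<in> verts G" "u \<noteq> v"
  obtains (same) i j k where "u = vx i j" "v = vx i k" "i < 3" "j \<le> len i" "k \<le> len i" "j \<noteq> k"
      "cyclic_system u v = seg i j k" "cyclic_system v u = seg i k j"
  | (cross) i j i' k where "u = vx i j" "v = vx i' k" "i < 3" "i' < 3" "i \<noteq> i'"
      "0 < j" "j < len i" "0 < k" "k < len i'"
proof -
  obtain i j where u: "u = vx i j" "i < 3" "j \<le> len i"
    using assms(1) by (auto simp: verts_G)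
  obtain i' k where v: "v = vx i' k" "i' < 3" "k \<le> len i'"
    using assms(2) by (auto simp: verts_G)
  have ends: ?thesis if "u = vx 0 p" "v = vx 0 q" "p = 0 \<and> q = len 0 \<or> p = len 0 \<and> q = 0" for p q
    by (rule same[of 0 p q]) (use that len_pos[of 0] in \<open>auto simp del: len_pos\<close>)
  have inner: ?thesis if "u = vx n p" "v = vx n q" "n < 3" "p \<le> len n" "q \<le> len n" "p \<noteq> q"
    "0 < p \<and> p < len n \<or> 0 < q \<and> q < len n" for n p q
    by (rule same[of n p q]) (use that cyclic_system_seg[of n p q] cyclic_system_seg[of n q p] in auto)
  consider (cross') "0 < j \<and> j < len i" "0 < k \<and> k < len i'" "i \<noteq> i'"
    | (same') "0 < j \<and> j < len i" "i = i'"
    | (left) "0 < j \<and> j < len i" "\<not> (0 < k \<and> k < len i')"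
    | (right) "\<not> (0 < j \<and> j < len i)" "0 < k \<and> k < len i'"
    | (ends') "\<not> (0 < j \<and> j < len i)" "\<not> (0 < k \<and> k < len i')"
    by blast
  then show ?thesis
  proof cases
    case cross'
    then show ?thesis
      using cross u v by blast
  next
    case same'
    then show ?thesis
      using inner[of i j k] u v assms(3) by auto
  next
    case left
    then have "k = 0 \<or> k = len i'"
      using v(3) by auto
    then show ?thesis
      using inner[of i j 0] inner[of i j "len i"] left u v by auto
  next
    case right
    then have "j = 0 \<or> j = len i"
      using u(3) by auto
    then show ?thesis
      using inner[of i' 0 k] inner[of i' "len i'" k] right u v by auto
  next
    case ends'
    then have "j = 0 \<or> j = len i" "k = 0 \<or> k = len i'"
      using u(3) v(3) by auto
    then have "u = vx 0 0 \<and> v = vx 0 (len 0) \<or> u = vx 0 (len 0) \<and> v = vx 0 0"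
      using assms(3) u v by auto
    then show ?thesis
      using ends by blast
  qed
qed

lemma cyclic_via_S_commute:
  assumes "i < 3" "i' < 3" "i \<noteq> i'"
  shows "cyclic_via_S i j i' k \<longleftrightarrow> cyclic_via_S i' k i j"
proof -
  have "i' = Suc i mod 3 \<longleftrightarrow> i \<noteq> Suc i' mod 3"
  proof -
    have "i = 0 \<or> i = 1 \<or> i = 2" "i' = 0 \<or> i' = 1 \<or> i' = 2"
      using assms(1,2) by linarith+
    then show ?thesis
      using assms(3) by (elim disjE) simp_all
  qed
  then show ?thesis
    by (auto simp: cyclic_via_S_def)
qed

lemma cyclic_system_cross:
  assumes "i < 3" "i' < 3" "i \<noteq> i'" "0 < j" "j < len i" "0 < k" "k < len i'"
  shows "cyclic_system (vx i j) (vx i' k) =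
    (if cyclic_via_S i j i' k then seg i j 0 \<frown> seg i' 0 k else seg i j (len i) \<frown> seg i' (len i') k)"
  using assms by (simp add: vx_inner)

lemma path_system_cyclic_system: "path_system G cyclic_system"
  unfolding path_system_def
proof (intro ballI impI)
  fix u v assume uv: "u \<in> verts G" "v \<in> verts G" "u \<noteq> v"
  then show "is_path G u v (cyclic_system u v) \<and> cyclic_system v u = rev_path (cyclic_system u v)"
  proof (cases rule: cyclic_system_cases)
    case (same i j k)
    then show ?thesis
      using is_path_seg by simp
  next
    case (cross i j i' k)
    have "cyclic_via_S i' k i j \<longleftrightarrow> cyclic_via_S i j i' k"
      using cyclic_via_S_commute cross by simp
    then have "cyclic_system v u = rev_path (cyclic_system u v)"
      using cross by (simp add: cyclic_system_cross rev_path_join)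
    moreover have "is_path G u v (cyclic_system u v)"
      using is_path_via_S[of i i' j k] is_path_via_T[of i i' j k] cross
      by (simp add: cyclic_system_cross)
    ultimately show ?thesis
      by simp
  qed
qed

text \<open>Removing the first edge moves the first vertex along its arm, which matters only if that arm decides.
Then a path through \<open>BranchS\<close> starts next to \<open>BranchS\<close> and is left with a part of the other arm; a
path through \<open>BranchT\<close> moves further away from \<open>BranchS\<close>, so its choice of branch vertex is preserved.\<close>

lemma consistent_cyclic_system: "consistent G cyclic_system"
proof (rule consistent_if_tl_paths[OF path_system_cyclic_system])
  fix u v assume uv: "u \<in> verts G" "v \<in> verts G" "u \<noteq> v" and long: "2 \<le> length (pedges (cyclic_system u v))"
  show "cyclic_system (pverts (cyclic_system u v) ! 1) v = tl_path (cyclic_system u v)"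
    using uv
  proof (cases rule: cyclic_system_cases)
    case (same i j k)
    define j' where "j' = (if j < k then Suc j else j - 1)"
    have "tl_path (seg i j k) = seg i j' k" "pverts (seg i j k) ! 1 = vx i j'"
      using same leg_second[of j k "len i" i] by (auto simp: j'_def tl_path_leg_up tl_path_leg_down)
    moreover have "cyclic_system (vx i j') (vx i k) = seg i j' k"
      by (rule cyclic_system_seg) (use same long in \<open>auto simp: j'_def length_pedges_leg split: if_splits\<close>)
    ultimately show ?thesis
      using same by simp
  next
    case (cross i j i' k)
    show ?thesis
    proof (cases "cyclic_via_S i j i' k")
      case True
      have sys: "cyclic_system u v = seg i j 0 \<frown> seg i' 0 k"
        using cross True by (simp add: cyclic_system_cross)
      have tl: "tl_path (cyclic_system u v) = seg i (j - 1) 0 \<frown> seg i' 0 k"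
        unfolding sys using cross by (simp add: tl_path_join tl_path_leg_down)
      have snd: "pverts (cyclic_system u v) ! 1 = vx i (j - 1)"
        unfolding sys using cross leg_second[of j 0 "len i" i] wf_leg[of "len i" i j 0]
        by (simp add: nth_join wf_path_def length_pedges_leg)
      show ?thesis
      proof (cases "j = 1")
        case True
        have "seg i 0 0 \<frown> seg i' 0 k = seg i' 0 k"
          using join_trivial[of "seg i' 0 k"] by (simp add: leg_refl)
        then show ?thesis
          unfolding tl snd using True cross by (simp add: vx_inner)
      next
        case False
        then have "cyclic_via_S i (j - 1) i' k"
          using \<open>cyclic_via_S i j i' k\<close> by (auto simp: cyclic_via_S_def split: if_splits)
        then show ?thesis
          unfolding tl snd using False cross by (simp add: cyclic_system_cross)
      qed
    next
      case False
      have sys: "cyclic_system u v = seg i j (len i) \<frown> seg i' (len i') k"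
        using cross False by (simp add: cyclic_system_cross)
      have tl: "tl_path (cyclic_system u v) = seg i (Suc j) (len i) \<frown> seg i' (len i') k"
        unfolding sys using cross by (simp add: tl_path_join tl_path_leg_up)
      have snd: "pverts (cyclic_system u v) ! 1 = vx i (Suc j)"
        unfolding sys using cross leg_second[of j "len i" "len i" i] wf_leg[of "len i" i j "len i"]
        by (simp add: nth_join wf_path_def length_pedges_leg)
      show ?thesis
      proof (cases "Suc j = len i")
        case True
        have "seg i (len i) (len i) \<frown> seg i' (len i') k = seg i' (len i') k"
          using join_trivial[of "seg i' (len i') k"] cross by (simp add: leg_refl)
        then show ?thesis
          unfolding tl snd using True cross by (simp add: vx_inner)
      next
        case False
        then have "\<not> cyclic_via_S i (Suc j) i' k"
          using \<open>\<not> cyclic_via_S i j i' k\<close> cross by (auto simp: cyclic_via_S_def split: if_splits)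
        then show ?thesis
          unfolding tl snd using False cross by (simp add: cyclic_system_cross)
      qed
    qed
  qed
qed

text \<open>The difference of weight between the paths through \<open>BranchT\<close> and through \<open>BranchS\<close> is the sum of
the potentials of the two vertices.\<close>

lemma cyclic_weight_S:
  fixes w :: "nat \<times> nat \<Rightarrow> real"
  assumes "i < 3" "i' = Suc i mod 3" "len i \<ge> 3" "0 < k" "k < len i'"
  defines "\<delta> \<equiv> (arm_dist w i (len i) - 2 * arm_dist w i 1) + (arm_dist w i' (len i') - 2 * arm_dist w i' k)"
  shows "induces G w cyclic_system \<Longrightarrow> 0 \<le> \<delta>" "strictly_induces G w cyclic_system \<Longrightarrow> 0 < \<delta>"
proof -
  have i: "i' < 3" "i \<noteq> i'"
    using assms(1,2) by (auto simp: mod_Suc)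
  let ?S = "seg i 1 0 \<frown> seg i' 0 k" and ?T = "seg i 1 (len i) \<frown> seg i' (len i') k"
  have sys: "cyclic_system (vx i 1) (vx i' k) = ?S"
    using cyclic_system_cross[of i i' 1 k] i assms by (simp add: cyclic_via_S_def)
  have path: "is_path G (vx i 1) (vx i' k) ?T"
    using is_path_via_T[of i i' 1 k] i assms by simp
  have ne: "vx i 1 \<noteq> vx i' k"
    using i assms by (simp add: vx_eq_iff)
  have "hd (pedges ?T) \<noteq> hd (pedges ?S)"
    using assms(3) by (simp add: join_def hd_pedges_leg)
  then have diff: "?T \<noteq> ?S"
    by metis
  have weights: "path_weight w ?S = arm_dist w i 1 + arm_dist w i' k"
    "path_weight w ?T = (arm_dist w i (len i) - arm_dist w i 1) + (arm_dist w i' (len i') - arm_dist w i' k)"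
    using i assms by (simp_all add: weight_via_S weight_via_T)
  have verts: "vx i 1 \<in> verts G" "vx i' k \<in> verts G"
    using i assms by simp_all
  show "0 \<le> \<delta>" if "induces G w cyclic_system"
  proof -
    have "path_weight w (cyclic_system (vx i 1) (vx i' k)) \<le> path_weight w ?T"
      using that verts ne path unfolding induces_def by blast
    then show ?thesis
      unfolding sys weights \<delta>_def by simp
  qed
  show "0 < \<delta>" if "strictly_induces G w cyclic_system"
  proof -
    have "?T \<noteq> cyclic_system (vx i 1) (vx i' k)"
      unfolding sys by (rule diff)
    then have "path_weight w (cyclic_system (vx i 1) (vx i' k)) < path_weight w ?T"
      using that verts ne path unfolding strictly_induces_def by blast
    then show ?thesis
      unfolding sys weights \<delta>_def by simp
  qed
qed

lemma cyclic_weight_T: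
  fixes w :: "nat \<times> nat \<Rightarrow> real"
  assumes "i < 3" "i' = Suc i mod 3" "len i \<ge> 3" "0 < k" "k < len i'"
  defines "\<delta> \<equiv> (arm_dist w i (len i) - 2 * arm_dist w i 2) + (arm_dist w i' (len i') - 2 * arm_dist w i' k)"
  shows "induces G w cyclic_system \<Longrightarrow> \<delta> \<le> 0" "strictly_induces G w cyclic_system \<Longrightarrow> \<delta> < 0"
proof -
  have i: "i' < 3" "i \<noteq> i'"
    using assms(1,2) by (auto simp: mod_Suc)
  let ?S = "seg i 2 0 \<frown> seg i' 0 k" and ?T = "seg i 2 (len i) \<frown> seg i' (len i') k"
  have sys: "cyclic_system (vx i 2) (vx i' k) = ?T"
    using cyclic_system_cross[of i i' 2 k] i assms by (simp add: cyclic_via_S_def)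
  have path: "is_path G (vx i 2) (vx i' k) ?S"
    using is_path_via_S[of i i' 2 k] i assms by simp
  have ne: "vx i 2 \<noteq> vx i' k"
    using i assms by (simp add: vx_eq_iff)
  have "hd (pedges ?T) \<noteq> hd (pedges ?S)"
    using assms(3) by (simp add: join_def hd_pedges_leg)
  then have diff: "?S \<noteq> ?T"
    by metis
  have weights: "path_weight w ?S = arm_dist w i 2 + arm_dist w i' k"
    "path_weight w ?T = (arm_dist w i (len i) - arm_dist w i 2) + (arm_dist w i' (len i') - arm_dist w i' k)"
    using i assms by (simp_all add: weight_via_S weight_via_T)
  have verts: "vx i 2 \<in> verts G" "vx i' k \<in> verts G"
    using i assms by simp_all
  show "\<delta> \<le> 0" if "induces G w cyclic_system"
  proof -
    have "path_weight w (cyclic_system (vx i 2) (vx i' k)) \<le> path_weight w ?S"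
      using that verts ne path unfolding induces_def by blast
    then show ?thesis
      unfolding sys weights \<delta>_def by simp
  qed
  show "\<delta> < 0" if "strictly_induces G w cyclic_system"
  proof -
    have "?S \<noteq> cyclic_system (vx i 2) (vx i' k)"
      unfolding sys by (rule diff)
    then have "path_weight w (cyclic_system (vx i 2) (vx i' k)) < path_weight w ?S"
      using that verts ne path unfolding strictly_induces_def by blast
    then show ?thesis
      unfolding sys weights \<delta>_def by simp
  qed
qed

text \<open>The three sums of potentials that have to be positive and the three that have to be negative
contain the first two inner vertices of each arm once.\<close>

lemma not_strictly_metrizable_if_arms_ge_3:
  assumes "\<And>i. i < 3 \<Longrightarrow> 3 \<le> len i"
  shows "\<not> strictly_metrizable G"
proof
  assume "strictly_metrizable G"
  then obtain w where w: "strictly_induces G w cyclic_system"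
    using path_system_cyclic_system consistent_cyclic_system
    by (auto simp: strictly_metrizable_def strictly_metrizable_system_def)
  have len: "2 < len 0" "2 < len 1" "2 < len 2"
    using assms[of 0] assms[of 1] assms[of 2] by simp_all
  show False
    using cyclic_weight_S(2)[of 0 1 2, OF _ _ _ _ _ w] cyclic_weight_S(2)[of 1 2 2, OF _ _ _ _ _ w]
      cyclic_weight_S(2)[of 2 0 2, OF _ _ _ _ _ w] cyclic_weight_T(2)[of 0 1 1, OF _ _ _ _ _ w]
      cyclic_weight_T(2)[of 1 2 1, OF _ _ _ _ _ w] cyclic_weight_T(2)[of 2 0 1, OF _ _ _ _ _ w] len
    by simp
qed

text \<open>One of the six inequalities is used for the third instead of the second inner vertex of arm 2; their
sum then says that the potential does not decrease between these two vertices.\<close>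

lemma not_metrizable_if_arms_ge_3:
  assumes "\<And>i. i < 3 \<Longrightarrow> 3 \<le> len i" "4 \<le> len 2"
  shows "\<not> metrizable G"
proof
  assume "metrizable G"
  then obtain w where w: "\<And>e. e \<in> edges G \<Longrightarrow> 0 < w e" "induces G w cyclic_system"
    using path_system_cyclic_system consistent_cyclic_system
    unfolding metrizable_def metrizable_system_def by blast
  have len: "2 < len 0" "2 < len 1" "3 < len 2"
    using assms(1)[of 0] assms(1)[of 1] assms(2) by simp_all
  have "0 < w (2, 2)"
    using w(1) len by (simp add: edges_G)
  then have "arm_dist w 2 2 < arm_dist w 2 3"
    by (simp add: arm_dist_def numeral_3_eq_3 numeral_2_eq_2)
  then show False
    using cyclic_weight_S(1)[of 0 1 2, OF _ _ _ _ _ w(2)] cyclic_weight_S(1)[of 1 2 3, OF _ _ _ _ _ w(2)]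
      cyclic_weight_S(1)[of 2 0 2, OF _ _ _ _ _ w(2)] cyclic_weight_T(1)[of 0 1 1, OF _ _ _ _ _ w(2)]
      cyclic_weight_T(1)[of 1 2 1, OF _ _ _ _ _ w(2)] cyclic_weight_T(1)[of 2 0 1, OF _ _ _ _ _ w(2)] len
    by simp
qed

end

section \<open>The classification\<close>

theorem theorem1p1:
  fixes a b c :: nat
  assumes "1 \<le> a" and "a \<le> b" and "b \<le> c"
  shows "(metrizable (theta a b c) \<longleftrightarrow> a \<le> 2 \<or> (a, b, c) = (3, 3, 3)) \<and>
         (\<not> metrizable (theta a b c) \<longleftrightarrow> a \<ge> 3 \<and> b \<ge> 3 \<and> c \<ge> 4) \<and>
         (strictly_metrizable (theta a b c) \<longleftrightarrow> a \<le> 2)"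
proof -
  interpret theta_arms a b c
    using assms by unfold_locales auto
  have len: "len 0 = a" "len 1 = b" "len 2 = c"
    by (simp_all add: len_def)
  have all: "Q (len i)" if "i < 3" "Q a" "Q b" "Q c" for Q i
  proof -
    have "i = 0 \<or> i = 1 \<or> i = 2"
      using that(1) by linarith
    then show ?thesis
      using that len by auto
  qed
  have short: "strictly_metrizable G" if "a \<le> 2"
    using strictly_metrizable_if_short_arm[of 0] len that by simp
  have short': "metrizable G" if "a \<le> 2"
    using short[OF that] strictly_metrizable_system_imp_metrizable_system
    by (auto simp: metrizable_def strictly_metrizable_def)
  have tight: "metrizable G" if "(a, b, c) = (3, 3, 3)"
    by (rule metrizable_if_all_arms_3, rule all) (use that in auto)
  have long: "\<not> strictly_metrizable G" if "3 \<le> a"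
    by (rule not_strictly_metrizable_if_arms_ge_3, rule all) (use that assms in auto)
  have long': "\<not> metrizable G" if "3 \<le> a" "4 \<le> c"
    by (rule not_metrizable_if_arms_ge_3, rule all) (use that assms len in auto)
  consider "a \<le> 2" | "(a, b, c) = (3, 3, 3)" | "3 \<le> a" "3 \<le> b" "4 \<le> c"
    using assms by force
  then show ?thesis
  proof cases
    case 1
    then show ?thesis
      using short short' by auto
  next
    case 2
    then show ?thesis
      using tight long by auto
  next
    case 3
    then show ?thesis
      using long long' by auto
  qed
qed

end
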